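(* Let $G$ be a finite non-abelian group. Then $G$ is an F-group with $|\mathrm{Cent}(G)| \geq \frac{|G|}{2}$ if and only if $G \cong A_4$, or $G$ is an extraspecial $2$-group, or $G$ is a Frobenius group with abelian kernel and complement of order $2$.
   Context: For a group $G$ and $x\in G$, $C(x)$ is the centralizer of $x$ in $G$, $Z(G)$ is the center and $G'$ is the commutator subgroup of $G$. $\mathrm{Cent}(G)=\{C(x) : x\in G\}$ is the set of all element centralizers. $G$ is an F-group if for all $x,y\in G\setminus Z(G)$, $C(x)\leq C(y)$ implies $C(x)=C(y)$. A finite $p$-group $G$ ($p$ prime) is extraspecial if $G'=Z(G)$ has order $p$ and $G/G'$ is elementary abelian. $A_4$ is the alternating group of degree $4$. *)

theory Defs
  imports Complex_Main "HOL-Algebra.Algebra"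
begin

definition centralizer :: "('a, 'b) monoid_scheme \<Rightarrow> 'a \<Rightarrow> 'a set" where
  "centralizer G x = {g \<in> carrier G. g \<otimes>\<^bsub>G\<^esub> x = x \<otimes>\<^bsub>G\<^esub> g}"

definition center :: "('a, 'b) monoid_scheme \<Rightarrow> 'a set" where
  "center G = {z \<in> carrier G. \<forall>g \<in> carrier G. z \<otimes>\<^bsub>G\<^esub> g = g \<otimes>\<^bsub>G\<^esub> z}"

definition Cent :: "('a, 'b) monoid_scheme \<Rightarrow> 'a set set" where
  "Cent G = centralizer G ` carrier G"

definition F_group :: "('a, 'b) monoid_scheme \<Rightarrow> bool" where
  "F_group G \<longleftrightarrow> group G \<and>
     (\<forall>x \<in> carrier G - center G. \<forall>y \<in> carrier G - center G.
        centralizer G x \<subseteq> centralizer G y \<longrightarrow> centralizer G x = centralizer G y)"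

definition elementary_abelian :: "nat \<Rightarrow> ('a, 'b) monoid_scheme \<Rightarrow> bool" where
  "elementary_abelian p G \<longleftrightarrow>
     comm_group G \<and> (\<forall>x \<in> carrier G. x [^]\<^bsub>G\<^esub> p = \<one>\<^bsub>G\<^esub>)"

definition extraspecial :: "nat \<Rightarrow> ('a, 'b) monoid_scheme \<Rightarrow> bool" where
  "extraspecial p G \<longleftrightarrow>
     group G \<and> Factorial_Ring.prime p \<and> finite (carrier G) \<and> (\<exists>n. order G = p ^ n) \<and>
     derived G (carrier G) = center G \<and> card (center G) = p \<and>
     elementary_abelian p (G Mod derived G (carrier G))"

definition conjugate_subset :: "('a, 'b) monoid_scheme \<Rightarrow> 'a \<Rightarrow> 'a set \<Rightarrow> 'a set" where
  "conjugate_subset G g H = g <#\<^bsub>G\<^esub> H #>\<^bsub>G\<^esub> (inv\<^bsub>G\<^esub> g)"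

text \<open>
  A (finite) Frobenius group with complement \<open>H\<close>: \<open>H\<close> is a nontrivial proper subgroup meeting
  each of its conjugates by elements outside \<open>H\<close> trivially.
  The associated kernel consists of the identity and all elements in no conjugate of \<open>H\<close>;
  it is a subgroup by Frobenius' theorem.
\<close>

definition frobenius_complement :: "('a, 'b) monoid_scheme \<Rightarrow> 'a set \<Rightarrow> bool" where
  "frobenius_complement G H \<longleftrightarrow>
     group G \<and> finite (carrier G) \<and> subgroup H G \<and> H \<noteq> {\<one>\<^bsub>G\<^esub>} \<and> H \<noteq> carrier G \<and>
     (\<forall>g \<in> carrier G - H. H \<inter> conjugate_subset G g H = {\<one>\<^bsub>G\<^esub>})"

definition frobenius_kernel :: "('a, 'b) monoid_scheme \<Rightarrow> 'a set \<Rightarrow> 'a set" where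
  "frobenius_kernel G H =
     insert \<one>\<^bsub>G\<^esub> (carrier G - (\<Union>g \<in> carrier G. conjugate_subset G g H))"

end

theory Submission
  imports Defs
begin

text \<open>
  Everything comes from counting the fibers of the map \<open>x \<mapsto> C(x)\<close>. It is constant on cosets of
  the center \<open>Z\<close>, so a group with at least \<open>|G| / 2\<close> centralizers has \<open>|Z| \<le> 2\<close>.

  If \<open>|Z| = 2\<close>, the count is tight and every fiber is a single coset of \<open>Z\<close>. Since \<open>x\<close> and its inverse
  have the same centralizer, all squares are central, and the group is extraspecial
  (\<open>squares_central_if_card_Cent_eq_index\<close>, \<open>extraspecial_if_squares_central\<close>).

  If \<open>Z\<close> is trivial, the F-group condition says that the centers of the proper centralizers partition
  the nonidentity elements, with the fibers as blocks. A block with a single element \<open>x\<close> is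
  possible only when \<open>C(x) = {1, x}\<close> (\<open>centralizer_pair_if_singleton_fiber\<close>). Then the conjugates of \<open>x\<close> fill
  half of the group, and their complement is an abelian subgroup inverted by \<open>x\<close>, so the group is
  Frobenius (\<open>frobenius_if_centralizer_pair\<close>). If there is no such block, all blocks have at least two
  elements; the number of centralizers then allows at most one larger block, of three elements. Without
  it the group would have exponent three and a nontrivial center. With it the group is a four-group
  extended by a cyclic permutation of its involutions, which is the alternating group of degree four
  (\<open>A4_coordinates_if_order_4_bicentralizer\<close>).

  Conversely, in the Frobenius case all proper centralizers are abelian, in the extraspecial case they
  all have index two, and for the alternating group the claim is a finite computation; in each case
  two distinct proper centralizers cannot be nested, and the centralizers are easily counted.
\<close>

section \<open>Counting along the fibers of a function\<close>

text \<open>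
  When a function is close to exactly \<open>k\<close>-to-one, the sum on the left is small, and it bounds both
  the number and the size of the fibers that exceed \<open>k\<close>.
\<close>

lemma fiber_excess:
  assumes "finite A" and "\<And>c. c \<in> f ` A \<Longrightarrow> k \<le> card {x \<in> A. f x = c}"
  shows "(\<Sum>c\<in>f ` A. card {x \<in> A. f x = c} - k) + k * card (f ` A) = card A"
proof -
  have "card A = (\<Sum>c\<in>f ` A. card {x \<in> A. f x = c})"
    using sum.image_gen[OF assms(1), of "\<lambda>_. 1::nat" f] by simp
  also have "\<dots> = (\<Sum>c\<in>f ` A. (card {x \<in> A. f x = c} - k) + k)"
    using assms(2) by (intro sum.cong) auto
  finally show ?thesis by (simp add: sum.distrib)
qed

lemma card_le_mult_card_image:
  assumes "finite A" and "\<And>c. c \<in> f ` A \<Longrightarrow> card {x \<in> A. f x = c} \<le> k"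
  shows "card A \<le> k * card (f ` A)"
proof -
  have "card A = (\<Sum>c\<in>f ` A. card {x \<in> A. f x = c})"
    using sum.image_gen[OF assms(1), of "\<lambda>_. 1::nat" f] by simp
  also have "\<dots> \<le> of_nat (card (f ` A)) * k"
    using assms(2) by (rule sum_bounded_above)
  finally show ?thesis by (simp add: mult.commute)
qed

section \<open>Centralizers and the center\<close>

lemma centralizerI: "g \<in> carrier G \<Longrightarrow> g \<otimes>\<^bsub>G\<^esub> x = x \<otimes>\<^bsub>G\<^esub> g \<Longrightarrow> g \<in> centralizer G x"
  by (simp add: centralizer_def)

lemma centralizerD: "g \<in> centralizer G x \<Longrightarrow> g \<otimes>\<^bsub>G\<^esub> x = x \<otimes>\<^bsub>G\<^esub> g"
  by (simp add: centralizer_def)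

lemma centralizer_carrier: "g \<in> centralizer G x \<Longrightarrow> g \<in> carrier G"
  by (simp add: centralizer_def)

context group
begin

lemma commutes_mult:
  assumes "a \<in> carrier G" "b \<in> carrier G" "c \<in> carrier G"
    and "a \<otimes> c = c \<otimes> a" "b \<otimes> c = c \<otimes> b"
  shows "(a \<otimes> b) \<otimes> c = c \<otimes> (a \<otimes> b)"
proof -
  have "(a \<otimes> b) \<otimes> c = a \<otimes> (c \<otimes> b)" using assms by (simp add: m_assoc)
  also have "\<dots> = (c \<otimes> a) \<otimes> b" using assms(1-3) by (simp add: m_assoc[symmetric] assms(4))
  finally show ?thesis using assms(1-3) by (simp add: m_assoc)
qed

lemma commutes_inv:
  assumes "a \<in> carrier G" "c \<in> carrier G" and "a \<otimes> c = c \<otimes> a"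
  shows "inv a \<otimes> c = c \<otimes> inv a"
proof -
  have "c = inv a \<otimes> (c \<otimes> a)" using assms by (simp add: inv_solve_left)
  then show ?thesis using assms(1,2) inv_solve_right[of "inv a \<otimes> c" c a] by (simp add: m_assoc)
qed

lemma subgroup_centralizer:
  assumes "x \<in> carrier G"
  shows "subgroup (centralizer G x) G"
proof (rule subgroupI)
  have "x \<in> centralizer G x" using assms by (simp add: centralizer_def)
  then show "centralizer G x \<noteq> {}" by blast
  show "inv a \<in> centralizer G x" if "a \<in> centralizer G x" for a
    using that assms commutes_inv[of a x] by (auto simp: centralizer_def)
  show "a \<otimes> b \<in> centralizer G x" if "a \<in> centralizer G x" "b \<in> centralizer G x" for a b
    using that assms commutes_mult[of a b x] by (auto simp: centralizer_def)
qed (auto simp: centralizer_def)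

lemma centralizer_sym:
  assumes "x \<in> carrier G" "y \<in> centralizer G x"
  shows "x \<in> centralizer G y"
  using assms by (simp add: centralizer_def)

lemma self_in_centralizer: "x \<in> carrier G \<Longrightarrow> x \<in> centralizer G x"
  by (simp add: centralizer_def)

lemma centerI:
  "z \<in> carrier G \<Longrightarrow> (\<And>g. g \<in> carrier G \<Longrightarrow> z \<otimes> g = g \<otimes> z) \<Longrightarrow> z \<in> center G"
  unfolding center_def by blast

lemma centerD:
  assumes "z \<in> center G"
  shows "z \<in> carrier G" and "g \<in> carrier G \<Longrightarrow> z \<otimes> g = g \<otimes> z"
  using assms unfolding center_def by blast+

lemma centralizer_eq_carrier_iff:
  assumes x: "x \<in> carrier G"
  shows "centralizer G x = carrier G \<longleftrightarrow> x \<in> center G"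
proof
  assume eq: "centralizer G x = carrier G"
  show "x \<in> center G"
  proof (rule centerI[OF x])
    fix g assume "g \<in> carrier G"
    with eq have "g \<in> centralizer G x" by blast
    from centralizerD[OF this] show "x \<otimes> g = g \<otimes> x" by (rule sym)
  qed
next
  assume "x \<in> center G"
  from centerD(2)[OF this] have "carrier G \<subseteq> centralizer G x"
    by (intro subsetI centralizerI) (assumption, rule sym)
  then show "centralizer G x = carrier G"
    by (auto dest: centralizer_carrier)
qed

lemma one_in_center: "\<one> \<in> center G"
  by (rule centerI) (simp_all only: l_one r_one one_closed)

lemma subgroup_center: "subgroup (center G) G"
proof (rule subgroupI)
  show "center G \<noteq> {}"
    using one_in_center by blast
  show "inv a \<in> center G" if "a \<in> center G" for a
    using centerD[OF that] by (intro centerI commutes_inv inv_closed) blast+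
  show "a \<otimes> b \<in> center G" if "a \<in> center G" "b \<in> center G" for a b
    using centerD[OF that(1)] centerD[OF that(2)] by (intro centerI commutes_mult m_closed) blast+
  show "center G \<subseteq> carrier G" by (simp add: center_def)
qed

lemma finite_Cent: "finite (carrier G) \<Longrightarrow> finite (Cent G)"
  by (simp add: Cent_def)

text \<open>
  If \<open>C(x) \<subseteq> C(y)\<close> with \<open>C(y)\<close> abelian, then \<open>x\<close> lies in \<open>C(y)\<close>, so all of \<open>C(y)\<close> commutes with \<open>x\<close>.
\<close>

lemma F_group_if_abelian_centralizers:
  assumes "\<And>x u v. x \<in> carrier G - center G \<Longrightarrow> u \<in> centralizer G x \<Longrightarrow> v \<in> centralizer G x
             \<Longrightarrow> u \<otimes> v = v \<otimes> u"
  shows "F_group G"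
proof -
  have "centralizer G x = centralizer G y"
    if x: "x \<in> carrier G - center G" and y: "y \<in> carrier G - center G"
      and sub: "centralizer G x \<subseteq> centralizer G y" for x y
  proof
    show "centralizer G y \<subseteq> centralizer G x"
    proof
      fix g assume g: "g \<in> centralizer G y"
      have "x \<in> centralizer G y" using sub self_in_centralizer x by auto
      from assms[OF y g this] show "g \<in> centralizer G x"
        using g by (simp add: centralizer_def)
    qed
  qed (rule sub)
  then show ?thesis unfolding F_group_def using group_axioms by blast
qed

lemma abelian_if_squares_one:
  assumes H: "subgroup H G" and sq: "\<And>x. x \<in> H \<Longrightarrow> x \<otimes> x = \<one>"
    and xy: "x \<in> H" "y \<in> H"
  shows "x \<otimes> y = y \<otimes> x"
proof -
  have inv: "inv u = u" if "u \<in> H" for u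
    using that sq subgroup.mem_carrier[OF H] inv_equality by blast
  have "x \<otimes> y = inv (x \<otimes> y)"
    using xy subgroup.m_closed[OF H] inv by simp
  also have "\<dots> = y \<otimes> x"
    using xy subgroup.mem_carrier[OF H] inv by (simp add: inv_mult_group)
  finally show ?thesis .
qed

text \<open>
  This is the center of the centralizer of \<open>x\<close>, written as an up-set of the inclusion order on
  centralizers, the order that the F-group condition speaks about.
\<close>

definition bicentralizer :: "'a \<Rightarrow> 'a set" where
  "bicentralizer x = {y \<in> carrier G. centralizer G x \<subseteq> centralizer G y}"

lemma subgroup_bicentralizer:
  assumes "x \<in> carrier G"
  shows "subgroup (bicentralizer x) G"
proof (rule subgroupI)
  show "bicentralizer x \<noteq> {}" using assms by (auto simp: bicentralizer_def)
  show "inv a \<in> bicentralizer x" if a: "a \<in> bicentralizer x" for a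
  proof -
    have "g \<in> centralizer G (inv a)" if "g \<in> centralizer G x" for g
    proof -
      have g: "g \<in> centralizer G a" using that a by (auto simp: bicentralizer_def)
      with a show ?thesis using commutes_inv[of a g] by (auto simp: centralizer_def bicentralizer_def)
    qed
    with a show ?thesis by (auto simp: bicentralizer_def)
  qed
  show "a \<otimes> b \<in> bicentralizer x" if ab: "a \<in> bicentralizer x" "b \<in> bicentralizer x" for a b
  proof -
    have "g \<in> centralizer G (a \<otimes> b)" if "g \<in> centralizer G x" for g
    proof -
      have g: "g \<in> centralizer G a" "g \<in> centralizer G b"
        using that ab by (auto simp: bicentralizer_def)
      with ab show ?thesis
        using commutes_mult[of a b g] by (auto simp: centralizer_def bicentralizer_def)
    qed
    with ab show ?thesis by (auto simp: bicentralizer_def)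
  qed
qed (auto simp: bicentralizer_def)

lemma self_in_bicentralizer: "x \<in> carrier G \<Longrightarrow> x \<in> bicentralizer x"
  by (simp add: bicentralizer_def)

lemma central_translate_centralizer:
  assumes "x \<in> carrier G" "z \<in> center G"
  shows "centralizer G (x \<otimes> z) = centralizer G x"
proof -
  have z: "z \<in> carrier G" "\<And>g. g \<in> carrier G \<Longrightarrow> g \<otimes> z = z \<otimes> g"
    using centerD[OF assms(2)] by simp_all
  have "g \<otimes> (x \<otimes> z) = (x \<otimes> z) \<otimes> g \<longleftrightarrow> g \<otimes> x = x \<otimes> g" if g: "g \<in> carrier G" for g
  proof -
    have "g \<otimes> (x \<otimes> z) = (g \<otimes> x) \<otimes> z" using assms(1) z(1) g by (rule_tac m_assoc[symmetric])
    moreover have "(x \<otimes> z) \<otimes> g = (x \<otimes> g) \<otimes> z"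
      using assms(1) z(1) g by (simp add: m_assoc z(2)[OF g])
    ultimately show ?thesis using assms(1) z(1) g by simp
  qed
  then show ?thesis by (auto simp: centralizer_def)
qed

section \<open>Groups of prime power order\<close>

text \<open>
  Any other prime divisor \<open>q\<close> of the order would give a subgroup of order \<open>q\<close> by Sylow's theorem,
  and its elements would have order dividing both \<open>q\<close> and \<open>p ^ k\<close>.
\<close>

lemma order_prime_power_if_exponent_prime_power:
  assumes p: "Factorial_Ring.prime (p::nat)" and fin: "finite (carrier G)"
    and pow: "\<And>x. x \<in> carrier G \<Longrightarrow> x [^] (p ^ k) = \<one>"
  shows "\<exists>n. order G = p ^ n"
proof -
  have "order G \<noteq> 0" using fin by (simp add: order_gt_0_iff_finite)
  then obtain m where m: "order G = p ^ multiplicity p (order G) * m" "\<not> p dvd m"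
    using multiplicity_decompose'[of "order G" p] p not_prime_unit by blast
  have "m = 1"
  proof (rule ccontr)
    assume "m \<noteq> 1"
    then obtain q where q: "Factorial_Ring.prime q" "q dvd m"
      using prime_factor_nat by blast
    have "q dvd order G" using q(2) by (subst m(1)) simp
    then obtain r where "order G = q ^ 1 * r" by auto
    from sylow_thm[OF q(1) group_axioms this fin]
    obtain H where H: "subgroup H G" "card H = q" by auto
    have "card H > 1" using H(2) q(1) prime_gt_1_nat by blast
    then obtain x where x: "x \<in> H" "x \<noteq> \<one>"
      using card_mono[of "{\<one>}" H] by (cases "H \<subseteq> {\<one>}") auto
    interpret H: group "G\<lparr>carrier := H\<rparr>" by (rule subgroup_imp_group[OF H(1)])
    have xG: "x \<in> carrier G" by (rule subgroup.mem_carrier[OF H(1) x(1)])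
    have "x [^] q = \<one>"
      using H.pow_order_eq_1[of x] x(1) H(2) by (simp add: order_def nat_pow_consistent[symmetric])
    then have "ord x dvd q" using pow_eq_id[OF xG] by blast
    moreover have "ord x dvd p ^ k" using pow[OF xG] pow_eq_id[OF xG] by blast
    moreover have "coprime q (p ^ k)"
      using q p m(2) by (metis coprime_power_right_iff primes_coprime)
    ultimately have "ord x = 1" by (rule coprime_common_divisor_nat[rotated])
    then show False using x xG ord_eq_1 by blast
  qed
  with m(1) show ?thesis by auto
qed

text \<open>
  The class equation modulo \<open>p\<close>: if only the identity were central, all other conjugacy classes
  would have order divisible by \<open>p\<close>, and the group would have order 1 modulo \<open>p\<close>.
\<close>

lemma prime_power_group_center_nontrivial:
  assumes p: "Factorial_Ring.prime (p::nat)" and ord: "order G = p ^ n" and n: "n > 0"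
  shows "center G \<noteq> {\<one>}"
proof
  assume triv: "center G = {\<one>}"
  define \<phi> where "\<phi> = (\<lambda>g. \<lambda>h \<in> carrier G. g \<otimes> h \<otimes> inv g)"
  interpret act: group_action G "carrier G" \<phi>
    unfolding \<phi>_def by (rule action_by_conjugation)
  have fin: "finite (carrier G)"
    using ord p by (metis order_gt_0_iff_finite prime_gt_0_nat zero_less_power)
  have one_orbit: "orbit G \<phi> \<one> = {\<one>}"
    by (auto simp: orbit_def \<phi>_def intro!: exI[of _ \<one>])
  have orbit_dvd: "p dvd card orb" if orb: "orb \<in> orbits G (carrier G) \<phi>" "orb \<noteq> {\<one>}" for orb
  proof -
    obtain x where x: "x \<in> carrier G" "orb = orbit G \<phi> x"
      using orb by (auto simp: orbits_def)
    have "card orb dvd p ^ n"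
      using act.orbit_stabilizer_theorem[OF x(1)] ord x(2) by (metis dvd_triv_left)
    then obtain i where i: "card orb = p ^ i" using divides_primepow_nat[OF p] by blast
    have "i \<noteq> 0"
    proof
      assume "i = 0"
      then obtain y where y: "orb = {y}" using i by (metis card_1_singletonE power_0)
      have "x \<in> orb" using x act.orbit_refl by simp
      then have orbx: "orbit G \<phi> x = {x}" using y x(2) by simp
      have "x \<in> center G"
      proof (rule centerI[OF x(1)])
        fix g assume g: "g \<in> carrier G"
        have "\<phi> g x \<in> orbit G \<phi> x" using g by (auto simp: orbit_def)
        then have "g \<otimes> x \<otimes> inv g = x" using orbx x by (simp add: \<phi>_def)
        then show "x \<otimes> g = g \<otimes> x"
          using g x(1) by (metis inv_closed inv_solve_right m_closed)
      qed
      then show False using triv one_orbit x(2) orb(2) by simp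
    qed
    then show ?thesis using i by simp
  qed
  have "{\<one>} \<in> orbits G (carrier G) \<phi>"
    unfolding orbits_def using one_orbit one_closed by (metis (mono_tags, lifting) mem_Collect_eq)
  moreover have "finite (orbits G (carrier G) \<phi>)"
    using fin by (auto simp: orbits_def Setcompr_eq_image)
  moreover have "order G = (\<Sum>orb\<in>orbits G (carrier G) \<phi>. card orb)"
    using act.disjoint_sum[OF fin, of "\<lambda>_. 1::nat"] by (simp add: order_def)
  ultimately have "order G = 1 + (\<Sum>orb\<in>orbits G (carrier G) \<phi> - {{\<one>}}. card orb)"
    by (simp add: sum.remove)
  moreover have "p dvd (\<Sum>orb\<in>orbits G (carrier G) \<phi> - {{\<one>}}. card orb)"
    using orbit_dvd by (intro dvd_sum) auto
  moreover have "p dvd order G" using ord n by simp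
  ultimately have "p dvd 1" by (metis dvd_add_left_iff)
  then show False using p not_prime_unit by blast
qed

section \<open>Centers of order two and extraspecial groups\<close>

text \<open>
  Modulo the center all squares vanish, so the quotient is elementary abelian and the commutator
  subgroup is a nontrivial subgroup of a center of order two. Fourth powers vanish in the group
  itself, which makes its order a power of two.
\<close>

lemma extraspecial_if_squares_central:
  assumes fin: "finite (carrier G)" and Z: "card (center G) = 2"
    and sq: "\<And>x. x \<in> carrier G \<Longrightarrow> x \<otimes> x \<in> center G"
    and nonab: "\<not> comm_group G"
  shows "extraspecial 2 G"
proof -
  have normal: "center G \<lhd> G"
    unfolding normal_inv_iff
  proof (intro conjI ballI subgroup_center)
    fix x h assume x: "x \<in> carrier G" and h: "h \<in> center G"
    have "x \<otimes> h \<otimes> inv x = h \<otimes> (x \<otimes> inv x)"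
      using x centerD(1)[OF h] by (simp only: centerD(2)[OF h x, symmetric] m_assoc inv_closed)
    then show "x \<otimes> h \<otimes> inv x \<in> center G"
      using x h centerD(1)[OF h] by simp
  qed
  interpret Q: group "G Mod center G" by (rule normal.factorgroup_is_group[OF normal])
  have Qsq: "Y \<otimes>\<^bsub>G Mod center G\<^esub> Y = \<one>\<^bsub>G Mod center G\<^esub>"
    if Y: "Y \<in> carrier (G Mod center G)" for Y
  proof -
    obtain x where x: "x \<in> carrier G" "Y = center G #> x"
      using Y by (auto simp: FactGroup_def RCOSETS_def)
    have "Y \<otimes>\<^bsub>G Mod center G\<^esub> Y = center G #> (x \<otimes> x)"
      using x normal.rcos_sum[OF normal] by (simp add: FactGroup_def)
    also have "\<dots> = center G"
      using sq x(1) coset_join2 subgroup_center by auto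
    finally show ?thesis by (simp add: FactGroup_def)
  qed
  have Qcomm: "comm_group (G Mod center G)"
    using Q.abelian_if_squares_one[OF Q.subgroup_self Qsq] by (intro Q.group_comm_groupI)
  have sub: "derived G (carrier G) \<subseteq> center G"
    by (rule derived_minimal[OF normal Qcomm])
  have nontriv: "derived G (carrier G) \<noteq> {\<one>}"
  proof
    assume triv: "derived G (carrier G) = {\<one>}"
    have "x \<otimes> y = y \<otimes> x" if xy: "x \<in> carrier G" "y \<in> carrier G" for x y
    proof -
      have "x \<otimes> y \<otimes> inv x \<otimes> inv y \<in> derived G (carrier G)"
        unfolding derived_def using xy by (intro generate.incl) blast
      then have "x \<otimes> y \<otimes> (inv x \<otimes> inv y) = \<one>"
        using triv xy by (simp add: m_assoc)
      then have "x \<otimes> y = inv (inv x \<otimes> inv y)"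
        using xy by (metis inv_closed inv_equality m_closed inv_inv)
      then show ?thesis using xy by (simp add: inv_mult_group)
    qed
    then show False using nonab group_comm_groupI by blast
  qed
  have finZ: "finite (center G)" using Z by (metis card.infinite zero_neq_numeral)
  have "\<one> \<in> derived G (carrier G)"
    using subgroup.one_closed[OF derived_is_subgroup[OF subset_refl]] .
  with nontriv obtain d where d: "d \<in> derived G (carrier G)" "d \<noteq> \<one>" by blast
  with \<open>\<one> \<in> derived G (carrier G)\<close> have "card {\<one>, d} \<le> card (derived G (carrier G))"
    using sub finZ by (intro card_mono) (auto intro: finite_subset)
  then have eq: "derived G (carrier G) = center G"
    using sub Z d finZ by (intro card_seteq) auto
  have "x [^] (2 ^ 2 :: nat) = \<one>" if x: "x \<in> carrier G" for x
  proof -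
    interpret Z: group "G\<lparr>carrier := center G\<rparr>" by (rule subgroup_imp_group[OF subgroup_center])
    have "(x \<otimes> x) [^] (2::nat) = \<one>"
      using Z.pow_order_eq_1[of "x \<otimes> x"] sq[OF x] Z nat_pow_consistent[of "x \<otimes> x" 2 "center G"]
      by (simp add: order_def)
    moreover have "x \<otimes> x = x [^] (2::nat)" using x by (simp add: numeral_2_eq_2)
    ultimately show ?thesis using x by (simp add: nat_pow_pow power2_eq_square)
  qed
  from order_prime_power_if_exponent_prime_power[OF two_is_prime_nat fin this]
  have "\<exists>n. order G = 2 ^ n" .
  moreover have "elementary_abelian 2 (G Mod center G)"
    unfolding elementary_abelian_def
  proof (intro conjI ballI Qcomm)
    fix Y assume Y: "Y \<in> carrier (G Mod center G)"
    have "Y [^]\<^bsub>G Mod center G\<^esub> (2::nat) = Y \<otimes>\<^bsub>G Mod center G\<^esub> Y"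
      by (simp only: numeral_2_eq_2 Q.nat_pow_Suc Q.nat_pow_0 Q.l_one[OF Y])
    then show "Y [^]\<^bsub>G Mod center G\<^esub> (2::nat) = \<one>\<^bsub>G Mod center G\<^esub>"
      using Qsq[OF Y] by simp
  qed
  ultimately show ?thesis
    unfolding extraspecial_def using eq Z fin group_axioms by simp
qed

section \<open>The fibers of the centralizer map\<close>

lemma central_coset_subset_fiber:
  assumes x: "x \<in> carrier G"
  shows "(\<lambda>z. x \<otimes> z) ` center G \<subseteq> {y \<in> carrier G. centralizer G y = centralizer G x}"
    and "card ((\<lambda>z. x \<otimes> z) ` center G) = card (center G)"
proof -
  show "(\<lambda>z. x \<otimes> z) ` center G \<subseteq> {y \<in> carrier G. centralizer G y = centralizer G x}"
    using x centerD(1) central_translate_centralizer by blast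
  have "inj_on (\<lambda>z. x \<otimes> z) (center G)"
    using x centerD(1) by (intro inj_onI) (meson l_cancel)
  then show "card ((\<lambda>z. x \<otimes> z) ` center G) = card (center G)" by (rule card_image)
qed

lemma card_center_le_fiber:
  assumes fin: "finite (carrier G)" and c: "c \<in> centralizer G ` carrier G"
  shows "card (center G) \<le> card {y \<in> carrier G. centralizer G y = c}"
proof -
  obtain x where x: "x \<in> carrier G" "c = centralizer G x" using c by blast
  show ?thesis
    using card_mono[OF _ central_coset_subset_fiber(1)[OF x(1)]]
      central_coset_subset_fiber(2)[OF x(1)] fin x(2) by simp
qed

lemma card_center_mult_card_Cent_le:
  assumes fin: "finite (carrier G)"
  shows "card (center G) * card (Cent G) \<le> order G"
  using fiber_excess[where f = "centralizer G", OF fin card_center_le_fiber[OF fin]]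
  by (simp add: Cent_def order_def)

text \<open>
  The hypothesis is the extremal case of the previous bound: every fiber is exactly one coset of the
  center. As \<open>x\<close> and its inverse have the same centralizer, they differ by a central factor.
\<close>

lemma squares_central_if_card_Cent_eq_index:
  assumes fin: "finite (carrier G)" and eq: "order G \<le> card (center G) * card (Cent G)"
    and x: "x \<in> carrier G"
  shows "x \<otimes> x \<in> center G"
proof -
  let ?F = "{y \<in> carrier G. centralizer G y = centralizer G x}"
  have "(\<Sum>c\<in>centralizer G ` carrier G.
      card {y \<in> carrier G. centralizer G y = c} - card (center G)) = 0"
    using fiber_excess[where f = "centralizer G", OF fin card_center_le_fiber[OF fin]] eq
    by (simp add: Cent_def order_def)
  then have "card ?F \<le> card (center G)"
    using fin x by simp
  then have F: "(\<lambda>z. x \<otimes> z) ` center G = ?F"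
    using central_coset_subset_fiber[OF x] fin by (intro card_seteq) simp_all
  have "centralizer G (inv x) = centralizer G x"
  proof -
    have "x \<in> bicentralizer (inv x)" "inv x \<in> bicentralizer x"
      using x subgroup.m_inv_closed[OF subgroup_bicentralizer self_in_bicentralizer]
      by (metis inv_closed inv_inv)+
    then show ?thesis unfolding bicentralizer_def by blast
  qed
  then have "inv x \<in> ?F" using x by simp
  then obtain z where z: "z \<in> center G" "inv x = x \<otimes> z" using F by blast
  have "x \<otimes> x \<otimes> z = \<one>"
    using x z centerD(1)[OF z(1)] by (simp add: m_assoc) (metis r_inv)
  then have "x \<otimes> x = inv z"
    using x centerD(1)[OF z(1)] by (metis inv_equality m_closed)
  then show ?thesis using subgroup.m_inv_closed[OF subgroup_center z(1)] by simp
qed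

section \<open>Self-centralizing involutions and Frobenius groups\<close>

definition conj_class :: "'a \<Rightarrow> 'a set" where
  "conj_class h = (\<lambda>g. g \<otimes> h \<otimes> inv g) ` carrier G"

lemma conj_class_carrier: "h \<in> carrier G \<Longrightarrow> conj_class h \<subseteq> carrier G"
  by (auto simp: conj_class_def)

lemma conj_commutes_iff:
  assumes "g \<in> carrier G" "u \<in> carrier G" "h \<in> carrier G"
  shows "u \<otimes> (g \<otimes> h \<otimes> inv g) = (g \<otimes> h \<otimes> inv g) \<otimes> u
    \<longleftrightarrow> (inv g \<otimes> u \<otimes> g) \<otimes> h = h \<otimes> (inv g \<otimes> u \<otimes> g)"
proof -
  have gg: "inv g \<otimes> (g \<otimes> v) = v" "g \<otimes> (inv g \<otimes> v) = v" if "v \<in> carrier G" for v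
    using that assms by (simp_all add: m_assoc[symmetric])
  have "u \<otimes> (g \<otimes> h \<otimes> inv g) = g \<otimes> ((inv g \<otimes> u \<otimes> g) \<otimes> h) \<otimes> inv g"
    using assms by (simp add: m_assoc gg)
  moreover have "(g \<otimes> h \<otimes> inv g) \<otimes> u = g \<otimes> (h \<otimes> (inv g \<otimes> u \<otimes> g)) \<otimes> inv g"
    using assms by (simp add: m_assoc gg)
  ultimately show ?thesis using assms by simp
qed

text \<open>
  The fibers of the conjugation map are the left cosets of the centralizer. This measures conjugacy
  classes, and it recovers \<open>g\<close> from the conjugate \<open>g h inv g\<close> up to a factor that commutes with \<open>h\<close>.
\<close>

lemma conj_eq_conj_iff:
  assumes "g \<in> carrier G" "g' \<in> carrier G" "h \<in> carrier G"
  shows "g' \<otimes> h \<otimes> inv g' = g \<otimes> h \<otimes> inv g \<longleftrightarrow> inv g \<otimes> g' \<in> centralizer G h"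
proof -
  have gg: "inv g \<otimes> (g \<otimes> v) = v" "g \<otimes> (inv g \<otimes> v) = v" if "v \<in> carrier G" for v
    using that assms by (simp_all add: m_assoc[symmetric])
  have gg': "inv g' \<otimes> (g' \<otimes> v) = v" "g' \<otimes> (inv g' \<otimes> v) = v" if "v \<in> carrier G" for v
    using that assms by (simp_all add: m_assoc[symmetric])
  have "g' \<otimes> h \<otimes> inv g' = g \<otimes> ((inv g \<otimes> g') \<otimes> h) \<otimes> inv g'"
    using assms by (simp add: m_assoc gg)
  moreover have "g \<otimes> h \<otimes> inv g = g \<otimes> (h \<otimes> (inv g \<otimes> g')) \<otimes> inv g'"
    using assms by (simp add: m_assoc gg gg')
  ultimately show ?thesis using assms by (simp add: centralizer_def)
qed

lemma involution_if_centralizer_pair: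
  assumes h: "h \<in> carrier G" "h \<noteq> \<one>" and C: "centralizer G h = {\<one>, h}"
  shows "h \<otimes> h = \<one>"
proof -
  have "h \<otimes> h \<in> {\<one>, h}"
    using subgroup.m_closed[OF subgroup_centralizer[OF h(1)]] self_in_centralizer[OF h(1)] C by blast
  then show ?thesis using h by auto
qed

lemma centralizer_conj_pair:
  assumes h: "h \<in> carrier G" "h \<noteq> \<one>" and C: "centralizer G h = {\<one>, h}"
    and t: "t \<in> conj_class h"
  shows "t \<noteq> \<one>" and "centralizer G t = {\<one>, t}"
proof -
  obtain g where g: "g \<in> carrier G" "t = g \<otimes> h \<otimes> inv g"
    using t by (auto simp: conj_class_def)
  have gg: "inv g \<otimes> (g \<otimes> v) = v" "g \<otimes> (inv g \<otimes> v) = v" if "v \<in> carrier G" for v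
    using that g(1) by (simp_all add: m_assoc[symmetric])
  show "t \<noteq> \<one>"
  proof
    assume "t = \<one>"
    moreover have "inv g \<otimes> (t \<otimes> g) = h" using g h by (simp add: m_assoc gg)
    ultimately have "inv g \<otimes> (\<one> \<otimes> g) = h" by (simp only:)
    then show False using g(1) h(2) by simp
  qed
  show "centralizer G t = {\<one>, t}"
  proof
    show "{\<one>, t} \<subseteq> centralizer G t"
      using g h self_in_centralizer[of t] subgroup.one_closed[OF subgroup_centralizer[of t]] by simp
    show "centralizer G t \<subseteq> {\<one>, t}"
    proof
      fix u assume u: "u \<in> centralizer G t"
      have uG: "u \<in> carrier G" using u by (rule centralizer_carrier)
      have "inv g \<otimes> u \<otimes> g \<in> centralizer G h"
        using centralizerD[OF u] conj_commutes_iff[OF g(1) uG h(1)] g uG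
        by (intro centralizerI) simp_all
      then have "inv g \<otimes> u \<otimes> g = \<one> \<or> inv g \<otimes> u \<otimes> g = h" using C by blast
      moreover have "u = g \<otimes> (inv g \<otimes> u \<otimes> g) \<otimes> inv g" using g uG by (simp add: m_assoc gg)
      ultimately have "u = g \<otimes> \<one> \<otimes> inv g \<or> u = g \<otimes> h \<otimes> inv g" by metis
      then show "u \<in> {\<one>, t}" using g by auto
    qed
  qed
qed

lemma order_le_twice_conj_class:
  assumes fin: "finite (carrier G)" and h: "h \<in> carrier G" and C: "centralizer G h = {\<one>, h}"
  shows "order G \<le> 2 * card (conj_class h)"
  unfolding conj_class_def order_def
proof (rule card_le_mult_card_image[OF fin])
  fix c assume "c \<in> (\<lambda>g. g \<otimes> h \<otimes> inv g) ` carrier G"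
  then obtain g where g: "g \<in> carrier G" "c = g \<otimes> h \<otimes> inv g" by blast
  have "{x \<in> carrier G. x \<otimes> h \<otimes> inv x = c} \<subseteq> {g, g \<otimes> h}"
  proof
    fix x assume x: "x \<in> {x \<in> carrier G. x \<otimes> h \<otimes> inv x = c}"
    then have "inv g \<otimes> x \<in> {\<one>, h}" using conj_eq_conj_iff[of g x h] g h C by simp
    moreover have "x = g \<otimes> (inv g \<otimes> x)" using x g by (simp add: m_assoc[symmetric])
    ultimately show "x \<in> {g, g \<otimes> h}" using g by auto
  qed
  then have "card {x \<in> carrier G. x \<otimes> h \<otimes> inv x = c} \<le> card {g, g \<otimes> h}"
    by (intro card_mono) simp_all
  also have "\<dots> \<le> 2" by (simp add: card_insert_if)
  finally show "card {x \<in> carrier G. x \<otimes> h \<otimes> inv x = c} \<le> 2" .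
qed

lemma conjugate_subset_pair:
  assumes "g \<in> carrier G"
  shows "conjugate_subset G g {\<one>, h} = {\<one>, g \<otimes> h \<otimes> inv g}"
  using assms by (auto simp: conjugate_subset_def l_coset_def r_coset_def)

lemma frobenius_kernel_pair:
  assumes h: "h \<in> carrier G" "h \<noteq> \<one>" and C: "centralizer G h = {\<one>, h}"
  shows "frobenius_kernel G {\<one>, h} = carrier G - conj_class h"
proof -
  have "(\<Union>g \<in> carrier G. conjugate_subset G g {\<one>, h}) = insert \<one> (conj_class h)"
    using conjugate_subset_pair by (auto simp: conj_class_def)
  moreover have "\<one> \<notin> conj_class h" using centralizer_conj_pair(1)[OF h C] by blast
  ultimately show ?thesis unfolding frobenius_kernel_def by auto
qed

text \<open>
  Let \<open>T\<close> be the conjugacy class of \<open>h\<close>. It consists of self-centralizing involutions and fills half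
  of the group. A product of two elements of \<open>T\<close> is never in \<open>T\<close>, for otherwise the two would commute
  and be equal, with product one. Hence left or right translation by any element of \<open>T\<close> exchanges
  \<open>T\<close> with its complement \<open>K\<close>. Writing \<open>a = s h\<close> and \<open>b = h t\<close> with \<open>s\<close> and \<open>t\<close> in \<open>T\<close> gives
  \<open>a b = s t\<close>, so \<open>K\<close> is a subgroup. Conjugation by \<open>h\<close> inverts \<open>K\<close>, and a group on which inversion is
  a homomorphism is abelian.
\<close>

lemma frobenius_if_centralizer_pair:
  assumes fin: "finite (carrier G)" and nonab: "\<not> comm_group G"
    and h: "h \<in> carrier G" "h \<noteq> \<one>" and C: "centralizer G h = {\<one>, h}"
  shows "frobenius_complement G {\<one>, h}"
    and "comm_group (G\<lparr>carrier := frobenius_kernel G {\<one>, h}\<rparr>)"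
proof -
  let ?T = "conj_class h"
  define K where "K = carrier G - ?T"
  note TC = conj_class_carrier[OF h(1)]
  note T1 = centralizer_conj_pair[OF h C]
  have hh: "h \<otimes> h = \<one>" by (rule involution_if_centralizer_pair[OF h C])
  have hT: "h \<in> ?T" using h(1) unfolding conj_class_def by (intro image_eqI[of _ _ \<one>]) simp_all
  have Tsq: "t \<otimes> t = \<one>" if "t \<in> ?T" for t
    using involution_if_centralizer_pair[of t] T1[OF that] TC that by blast
  have Tinv: "inv t = t" if "t \<in> ?T" for t
    using inv_equality[OF Tsq[OF that]] TC that by blast
  have TT: "s \<otimes> t \<in> K" if s: "s \<in> ?T" and t: "t \<in> ?T" for s t
  proof -
    have sG: "s \<in> carrier G" and tG: "t \<in> carrier G" using s t TC by blast+
    have "s \<otimes> t \<notin> ?T"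
    proof
      assume st: "s \<otimes> t \<in> ?T"
      have "s \<otimes> t = inv (s \<otimes> t)"
        using Tsq[OF st] sG tG by (metis inv_equality m_closed)
      also have "\<dots> = t \<otimes> s"
        using Tinv s t sG tG by (simp add: inv_mult_group)
      finally have "t \<in> centralizer G s" using tG by (intro centralizerI) simp_all
      then have "t = \<one> \<or> t = s" using T1(2)[OF s] by blast
      then have "s \<otimes> t = \<one>" using Tsq[OF s] T1(1)[OF t] by blast
      then show False using T1(1)[OF st] by blast
    qed
    then show ?thesis using sG tG by (simp add: K_def)
  qed
  have finT: "finite ?T" using TC fin by (rule finite_subset)
  \<comment> \<open>Both inclusions of translates of \<open>T\<close> into \<open>K\<close> are equalities because \<open>K\<close> is not larger than \<open>T\<close>.\<close>
  have cardK: "card K \<le> card ?T"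
    using order_le_twice_conj_class[OF fin h(1) C] card_Diff_subset[OF finT TC]
    by (simp add: K_def order_def)
  have finK: "finite K" using fin by (simp add: K_def)
  have left: "K = (\<lambda>t. s \<otimes> t) ` ?T" if s: "s \<in> ?T" for s
  proof (rule card_seteq[OF finK, symmetric])
    show "(\<lambda>t. s \<otimes> t) ` ?T \<subseteq> K" using TT s by blast
    have "inj_on (\<lambda>t. s \<otimes> t) ?T" using s TC by (intro inj_onI) (meson l_cancel subsetD)
    then show "card K \<le> card ((\<lambda>t. s \<otimes> t) ` ?T)" using cardK by (simp add: card_image)
  qed
  have right: "K = (\<lambda>t. t \<otimes> s) ` ?T" if s: "s \<in> ?T" for s
  proof (rule card_seteq[OF finK, symmetric])
    show "(\<lambda>t. t \<otimes> s) ` ?T \<subseteq> K" using TT s by blast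
    have "inj_on (\<lambda>t. t \<otimes> s) ?T" using s TC by (intro inj_onI) (meson r_cancel subsetD)
    then show "card K \<le> card ((\<lambda>t. t \<otimes> s) ` ?T)" using cardK by (simp add: card_image)
  qed
  have hhv: "h \<otimes> (h \<otimes> v) = v" if "v \<in> carrier G" for v
    using that h(1) hh by (simp add: m_assoc[symmetric])
  have inverted: "h \<otimes> (k \<otimes> h) = inv k" if k: "k \<in> K" for k
  proof -
    obtain s where s: "s \<in> ?T" "k = s \<otimes> h" using k right[OF hT] by blast
    have sG: "s \<in> carrier G" using s TC by blast
    have "inv k = h \<otimes> s"
      using s sG h(1) hT Tinv by (simp add: inv_mult_group)
    moreover have "k \<otimes> h = s" using s sG h(1) hh by (simp add: m_assoc)
    ultimately show ?thesis by simp
  qed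
  have prod: "a \<otimes> b \<in> K" "a \<otimes> b = b \<otimes> a" if ab: "a \<in> K" "b \<in> K" for a b
  proof -
    obtain s where s: "s \<in> ?T" "a = s \<otimes> h" using ab(1) right[OF hT] by blast
    obtain t where t: "t \<in> ?T" "b = h \<otimes> t" using ab(2) left[OF hT] by blast
    have sG: "s \<in> carrier G" and tG: "t \<in> carrier G" using s t TC by blast+
    have ab_eq: "a \<otimes> b = s \<otimes> t" using s t sG tG h(1) by (simp add: m_assoc hhv)
    then show "a \<otimes> b \<in> K" using TT s t by simp
    have "b \<otimes> a = h \<otimes> ((t \<otimes> s) \<otimes> h)" using s t sG tG h(1) by (simp add: m_assoc)
    also have "\<dots> = inv (t \<otimes> s)" by (rule inverted[OF TT[OF t(1) s(1)]])
    also have "\<dots> = s \<otimes> t" using s t sG tG Tinv by (simp add: inv_mult_group)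
    finally show "a \<otimes> b = b \<otimes> a" using ab_eq by simp
  qed
  have KG: "K \<subseteq> carrier G" by (auto simp: K_def)
  have subK: "subgroup K G"
  proof (rule subgroupI[OF KG])
    show "K \<noteq> {}" using TT[OF hT hT] by blast
    show "inv a \<in> K" if a: "a \<in> K" for a
    proof -
      obtain s where s: "s \<in> ?T" "a = s \<otimes> h" using a right[OF hT] by blast
      have sG: "s \<in> carrier G" using s TC by blast
      have "inv a = h \<otimes> s"
        using s sG h(1) hT Tinv by (simp add: inv_mult_group)
      then show ?thesis using TT[OF hT s(1)] by simp
    qed
  qed (rule prod(1))
  have "comm_group (G\<lparr>carrier := K\<rparr>)"
    by (rule group.group_comm_groupI[OF subgroup_imp_group[OF subK]]) (use prod(2) in simp)
  then show "comm_group (G\<lparr>carrier := frobenius_kernel G {\<one>, h}\<rparr>)"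
    using frobenius_kernel_pair[OF h C] by (simp add: K_def)
  have sub: "subgroup {\<one>, h} G" using subgroup_centralizer[OF h(1)] C by simp
  have proper: "{\<one>, h} \<noteq> carrier G"
  proof
    assume eq: "{\<one>, h} = carrier G"
    have "comm_group G"
    proof (rule group_comm_groupI)
      fix x y assume "x \<in> carrier G" "y \<in> carrier G"
      then show "x \<otimes> y = y \<otimes> x" using h(1) by (auto simp: eq[symmetric])
    qed
    then show False using nonab by blast
  qed
  have "{\<one>, h} \<inter> conjugate_subset G g {\<one>, h} = {\<one>}" if g: "g \<in> carrier G - {\<one>, h}" for g
  proof -
    have "g \<otimes> h \<otimes> inv g \<noteq> h"
    proof
      assume "g \<otimes> h \<otimes> inv g = h"
      then have "g \<otimes> h = h \<otimes> g" using g h(1) by (metis DiffD1 inv_closed inv_solve_right m_closed)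
      then have "g \<in> centralizer G h" using g by (intro centralizerI) simp_all
      then show False using C g by blast
    qed
    then show ?thesis using conjugate_subset_pair[of g h] g h(2) by auto
  qed
  then show "frobenius_complement G {\<one>, h}"
    unfolding frobenius_complement_def using fin sub proper h(2) group_axioms by auto
qed

lemma centralizer_pair_if_frobenius_complement_card_2:
  assumes frob: "frobenius_complement G H" and card: "card H = 2"
  obtains h where "H = {\<one>, h}" "h \<in> carrier G" "h \<noteq> \<one>" "centralizer G h = {\<one>, h}"
proof -
  have sub: "subgroup H G" using frob by (simp add: frobenius_complement_def)
  obtain a b where ab: "H = {a, b}" "a \<noteq> b" using card by (auto simp: card_2_iff)
  then obtain h where h: "H = {\<one>, h}" "h \<noteq> \<one>"
    using subgroup.one_closed[OF sub] by (metis insertE insert_commute singletonD)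
  have hG: "h \<in> carrier G" using subgroup.subset[OF sub] h by blast
  have "g \<in> {\<one>, h}" if g: "g \<in> centralizer G h" for g
  proof (rule ccontr)
    assume "g \<notin> {\<one>, h}"
    then have gG: "g \<in> carrier G" and "g \<in> carrier G - H"
      using centralizer_carrier[OF g] h by auto
    then have "H \<inter> conjugate_subset G g H = {\<one>}"
      using frob by (simp add: frobenius_complement_def)
    moreover have "g \<otimes> h \<otimes> inv g = h"
      using centralizerD[OF g] gG hG by (simp add: m_assoc)
    ultimately show False using conjugate_subset_pair[OF gG, of h] h by auto
  qed
  moreover have "{\<one>, h} \<subseteq> centralizer G h"
    using self_in_centralizer[OF hG] subgroup.one_closed[OF subgroup_centralizer[OF hG]] by blast
  ultimately have "centralizer G h = {\<one>, h}" by blast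
  with h hG that show thesis by blast
qed

text \<open>
  An element of the conjugacy class \<open>T\<close> of the involution in \<open>H\<close> has a centralizer of order two, and
  elements of \<open>T\<close> commute with no nontrivial element of the kernel. So a centralizer of a noncentral
  element has order two or lies in the abelian kernel, and the elements of \<open>T\<close>, which are half of
  the group, have pairwise distinct centralizers.
\<close>

lemma F_group_many_centralizers_if_frobenius:
  assumes frob: "frobenius_complement G H" and card: "card H = 2"
    and comm: "comm_group (G\<lparr>carrier := frobenius_kernel G H\<rparr>)"
  shows "F_group G" and "order G \<le> 2 * card (Cent G)"
proof -
  have fin: "finite (carrier G)" using frob by (simp add: frobenius_complement_def)
  obtain h where H: "H = {\<one>, h}" and h: "h \<in> carrier G" "h \<noteq> \<one>"
    and C: "centralizer G h = {\<one>, h}"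
    using centralizer_pair_if_frobenius_complement_card_2[OF frob card] .
  let ?T = "conj_class h"
  note TC = conj_class_carrier[OF h(1)]
  note T1 = centralizer_conj_pair[OF h C]
  have K: "frobenius_kernel G H = carrier G - ?T" using frobenius_kernel_pair[OF h C] H by simp
  have Kcomm: "u \<otimes> v = v \<otimes> u" if "u \<in> carrier G - ?T" "v \<in> carrier G - ?T" for u v
    using comm_monoid.m_comm[OF comm_group.axioms(1)[OF comm], of u v] that K by simp
  show "F_group G"
  proof (rule F_group_if_abelian_centralizers)
    fix x u v
    assume x: "x \<in> carrier G - center G" and u: "u \<in> centralizer G x" and v: "v \<in> centralizer G x"
    show "u \<otimes> v = v \<otimes> u"
    proof (cases "x \<in> ?T")
      case True
      then have "u \<in> {\<one>, x}" "v \<in> {\<one>, x}" using T1(2)[OF True] u v by simp_all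
      then show ?thesis using x by auto
    next
      case False
      have "w \<in> carrier G - ?T" if w: "w \<in> centralizer G x" for w
      proof -
        have "w \<notin> ?T"
        proof
          assume wT: "w \<in> ?T"
          have "x \<in> centralizer G w" using centralizer_sym w x by simp
          then have "x = \<one> \<or> x = w" using T1(2)[OF wT] by blast
          then show False using False wT x one_in_center by blast
        qed
        then show ?thesis using centralizer_carrier[OF w] by blast
      qed
      then show ?thesis using Kcomm u v by blast
    qed
  qed
  have "inj_on (centralizer G) ?T"
  proof (rule inj_onI)
    fix s t assume s: "s \<in> ?T" and t: "t \<in> ?T" and "centralizer G s = centralizer G t"
    then have "{\<one>, s} = {\<one>, t}" using T1(2) by simp
    then show "s = t" using T1(1)[OF s] by blast
  qed
  then have "card ?T \<le> card (Cent G)"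
    using card_mono[OF finite_Cent[OF fin], of "centralizer G ` ?T"] TC
    by (simp add: card_image Cent_def image_mono)
  then show "order G \<le> 2 * card (Cent G)"
    using order_le_twice_conj_class[OF fin h(1) C] by simp
qed

end

section \<open>Coordinates on the alternating group of degree four\<close>

text \<open>
  The triple \<open>(i, j, k)\<close> stands for \<open>a ^ i b ^ j y ^ k\<close>, where \<open>a\<close> and \<open>b\<close> are commuting involutions
  and \<open>y\<close> has order three and conjugates \<open>a\<close> to \<open>b\<close> and \<open>b\<close> to \<open>a b\<close>. A group with a
  multiplicative bijection from these triples is isomorphic to the alternating group of degree four,
  and statements about its centralizers become finite computations.
\<close>

definition A4_coords :: "(nat \<times> nat \<times> nat) set" where
  "A4_coords = {0, 1} \<times> {0, 1} \<times> {0, 1, 2}"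

text \<open>
  Conjugation by \<open>y\<close>, on the exponents of \<open>a\<close> and \<open>b\<close>.
\<close>

fun A4_rot :: "nat \<times> nat \<Rightarrow> nat \<times> nat" where
  "A4_rot (i, j) = (j, (i + j) mod 2)"

fun A4_mult :: "nat \<times> nat \<times> nat \<Rightarrow> nat \<times> nat \<times> nat \<Rightarrow> nat \<times> nat \<times> nat" where
  "A4_mult (i, j, k) (i', j', k') =
     (case (A4_rot ^^ k) (i', j') of (p, q) \<Rightarrow> ((i + p) mod 2, (j + q) mod 2, (k + k') mod 3))"

definition A4_coordinates :: "('a, 'b) monoid_scheme \<Rightarrow> (nat \<times> nat \<times> nat \<Rightarrow> 'a) \<Rightarrow> bool" where
  "A4_coordinates G w \<longleftrightarrow> bij_betw w A4_coords (carrier G) \<and>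
     (\<forall>s \<in> A4_coords. \<forall>t \<in> A4_coords. w s \<otimes>\<^bsub>G\<^esub> w t = w (A4_mult s t))"

definition A4_commutant :: "nat \<times> nat \<times> nat \<Rightarrow> (nat \<times> nat \<times> nat) set" where
  "A4_commutant t = {s \<in> A4_coords. A4_mult s t = A4_mult t s}"

lemma A4_mult_closed: "\<forall>s \<in> A4_coords. \<forall>t \<in> A4_coords. A4_mult s t \<in> A4_coords"
  by code_simp

text \<open>
  Left inverses in a form that reduces injectivity of a multiplicative map to triviality of its
  kernel.
\<close>

lemma A4_left_cancel:
  "\<forall>s \<in> A4_coords. \<exists>r \<in> A4_coords. A4_mult r s = (0, 0, 0) \<and>
     (\<forall>t \<in> A4_coords. A4_mult r t = (0, 0, 0) \<longrightarrow> t = s)"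
  by code_simp

text \<open>
  This is the F-group condition: the elements whose commutant is everything are the central ones, which
  the condition leaves out.
\<close>

lemma A4_commutant_antichain:
  "\<forall>s \<in> A4_coords. \<forall>t \<in> A4_coords. A4_commutant s \<subseteq> A4_commutant t \<longrightarrow>
     A4_commutant s = A4_commutant t \<or> A4_commutant t = A4_coords"
  by code_simp

lemma card_A4_commutants: "card (A4_commutant ` A4_coords) = 6"
  by code_simp

lemma card_A4_coords: "card A4_coords = 12"
  by code_simp

lemma is_iso_if_A4_coordinates:
  assumes v: "A4_coordinates G v" and w: "A4_coordinates H w"
  shows "G \<cong> H"
proof -
  let ?u = "inv_into A4_coords v"
  have bv: "bij_betw v A4_coords (carrier G)" and bw: "bij_betw w A4_coords (carrier H)"
    using v w by (auto simp: A4_coordinates_def)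
  have bu: "bij_betw ?u (carrier G) A4_coords" by (rule bij_betw_inv_into[OF bv])
  have "w \<circ> ?u \<in> hom G H"
  proof (rule homI)
    show "(w \<circ> ?u) x \<in> carrier H" if "x \<in> carrier G" for x
      using bij_betwE[OF bij_betw_trans[OF bu bw]] that by blast
    fix x y assume xy: "x \<in> carrier G" "y \<in> carrier G"
    have u: "?u x \<in> A4_coords" "?u y \<in> A4_coords" using bij_betwE[OF bu] xy by blast+
    have "x \<otimes>\<^bsub>G\<^esub> y = v (?u x) \<otimes>\<^bsub>G\<^esub> v (?u y)"
      using xy bij_betw_inv_into_right[OF bv] by simp
    also have "\<dots> = v (A4_mult (?u x) (?u y))" using v u unfolding A4_coordinates_def by blast
    finally have "?u (x \<otimes>\<^bsub>G\<^esub> y) = A4_mult (?u x) (?u y)"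
      using bij_betw_inv_into_left[OF bv] A4_mult_closed u by simp
    then show "(w \<circ> ?u) (x \<otimes>\<^bsub>G\<^esub> y) = (w \<circ> ?u) x \<otimes>\<^bsub>H\<^esub> (w \<circ> ?u) y"
      using w u unfolding A4_coordinates_def by simp
  qed
  then have "w \<circ> ?u \<in> iso G H" using bij_betw_trans[OF bu bw] by (simp add: iso_def)
  then show ?thesis unfolding is_iso_def by blast
qed

lemma A4_coordinates_transfer:
  assumes "group G" and iso: "G \<cong> H" and w: "A4_coordinates H w"
  shows "\<exists>v. A4_coordinates G v"
proof -
  obtain f where f: "f \<in> iso H G"
    using group.iso_sym[OF assms(1) iso] unfolding is_iso_def by blast
  have bw: "bij_betw w A4_coords (carrier H)" using w by (simp add: A4_coordinates_def)
  have "A4_coordinates G (f \<circ> w)"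
    unfolding A4_coordinates_def
  proof (intro conjI ballI)
    show "bij_betw (f \<circ> w) A4_coords (carrier G)"
      using bij_betw_trans[OF bw] f unfolding iso_def by blast
    fix s t assume st: "s \<in> A4_coords" "t \<in> A4_coords"
    have "w s \<in> carrier H" "w t \<in> carrier H" using bij_betwE[OF bw] st by blast+
    then have "f (w s) \<otimes>\<^bsub>G\<^esub> f (w t) = f (w s \<otimes>\<^bsub>H\<^esub> w t)"
      using f by (simp add: iso_def hom_def)
    also have "w s \<otimes>\<^bsub>H\<^esub> w t = w (A4_mult s t)" using w st unfolding A4_coordinates_def by blast
    finally show "(f \<circ> w) s \<otimes>\<^bsub>G\<^esub> (f \<circ> w) t = (f \<circ> w) (A4_mult s t)" by simp
  qed
  then show ?thesis by blast
qed

lemma A4_coordinates_centralizer: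
  assumes w: "A4_coordinates G w" and t: "t \<in> A4_coords"
  shows "centralizer G (w t) = w ` A4_commutant t"
proof -
  have bij: "bij_betw w A4_coords (carrier G)" using w by (simp add: A4_coordinates_def)
  have "w s \<otimes>\<^bsub>G\<^esub> w t = w t \<otimes>\<^bsub>G\<^esub> w s \<longleftrightarrow> A4_mult s t = A4_mult t s" if s: "s \<in> A4_coords" for s
  proof -
    have "w s \<otimes>\<^bsub>G\<^esub> w t = w (A4_mult s t)" "w t \<otimes>\<^bsub>G\<^esub> w s = w (A4_mult t s)"
      using w s t unfolding A4_coordinates_def by blast+
    then show ?thesis
      using inj_on_eq_iff[OF bij_betw_imp_inj_on[OF bij]] A4_mult_closed s t by simp
  qed
  then show ?thesis
    unfolding centralizer_def A4_commutant_def bij_betw_imp_surj_on[OF bij, symmetric] by blast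
qed

lemma F_group_if_A4_coordinates:
  assumes "group G" and w: "A4_coordinates G w"
  shows "F_group G" and "order G = 12" and "card (Cent G) = 6"
proof -
  interpret group G by fact
  have bij: "bij_betw w A4_coords (carrier G)" using w by (simp add: A4_coordinates_def)
  note inj = bij_betw_imp_inj_on[OF bij] and surj = bij_betw_imp_surj_on[OF bij]
  have sub: "A4_commutant t \<subseteq> A4_coords" for t by (auto simp: A4_commutant_def)
  have "centralizer G x = centralizer G y"
    if x: "x \<in> carrier G - center G" and y: "y \<in> carrier G - center G"
      and le: "centralizer G x \<subseteq> centralizer G y" for x y
  proof -
    obtain s t where s: "s \<in> A4_coords" "x = w s" and t: "t \<in> A4_coords" "y = w t"
      using x y surj by blast
    note C = A4_coordinates_centralizer[OF w s(1)] A4_coordinates_centralizer[OF w t(1)]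
    have "A4_commutant s \<subseteq> A4_commutant t"
    proof
      fix r assume r: "r \<in> A4_commutant s"
      then have "w r \<in> w ` A4_commutant t" using le C s t by blast
      then show "r \<in> A4_commutant t"
        using inj_on_image_mem_iff[OF inj subsetD[OF sub r] sub] by blast
    qed
    moreover have "A4_commutant t \<noteq> A4_coords"
    proof
      assume "A4_commutant t = A4_coords"
      then have "centralizer G y = carrier G" using C t surj by simp
      then show False using y centralizer_eq_carrier_iff by blast
    qed
    ultimately have "A4_commutant s = A4_commutant t"
      using A4_commutant_antichain s t by blast
    then show ?thesis using C s t by simp
  qed
  then show "F_group G" unfolding F_group_def using group_axioms by blast
  show "order G = 12"
    using bij_betw_same_card[OF bij] card_A4_coords by (simp add: order_def)
  have "Cent G = (\<lambda>t. w ` A4_commutant t) ` A4_coords"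
    unfolding Cent_def surj[symmetric] image_image
    using A4_coordinates_centralizer[OF w] by (rule image_cong[OF refl])
  also have "\<dots> = image w ` A4_commutant ` A4_coords" by (simp add: image_image)
  finally have Cent: "Cent G = image w ` A4_commutant ` A4_coords" .
  have "inj_on (image w) (A4_commutant ` A4_coords)"
    using inj_on_subset[OF inj_on_image_Pow[OF inj]] sub by blast
  then show "card (Cent G) = 6" unfolding Cent by (simp add: card_image card_A4_commutants)
qed

context group
begin

fun A4_word :: "'a \<Rightarrow> 'a \<Rightarrow> 'a \<Rightarrow> nat \<times> nat \<times> nat \<Rightarrow> 'a" where
  "A4_word a b y (i, j, k) = (a [^] i \<otimes> b [^] j) \<otimes> y [^] k"

lemma pow_mod_if_pow_one:
  assumes "x \<in> carrier G" and "x [^] (m::nat) = \<one>"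
  shows "x [^] (n mod m) = x [^] n"
proof -
  have "x [^] n = x [^] (m * (n div m) + n mod m)" by simp
  also have "\<dots> = (x [^] m) [^] (n div m) \<otimes> x [^] (n mod m)"
    using assms(1) by (simp only: nat_pow_mult[symmetric] nat_pow_pow)
  finally show ?thesis using assms by simp
qed

lemma pow_commutes_pow:
  assumes xy: "x \<in> carrier G" "y \<in> carrier G" and comm: "x \<otimes> y = y \<otimes> x"
  shows "x [^] (m::nat) \<otimes> y [^] (n::nat) = y [^] n \<otimes> x [^] m"
proof -
  have pow: "u [^] (k::nat) \<otimes> v = v \<otimes> u [^] k"
    if "u \<in> carrier G" "v \<in> carrier G" "u \<otimes> v = v \<otimes> u" for u v k
  proof (induction k)
    case (Suc k)
    have "(u [^] k \<otimes> u) \<otimes> v = v \<otimes> (u [^] k \<otimes> u)"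
      using that Suc by (intro commutes_mult nat_pow_closed)
    then show ?case by (simp only: nat_pow_Suc)
  qed (use that in simp)
  show ?thesis
    by (rule pow[OF xy(1) nat_pow_closed[OF xy(2)] pow[OF xy(2,1) comm[symmetric], symmetric]])
qed

context
  fixes a b y
  assumes carr: "a \<in> carrier G" "b \<in> carrier G" "y \<in> carrier G"
    and aa: "a \<otimes> a = \<one>" and bb: "b \<otimes> b = \<one>" and yyy: "y \<otimes> y \<otimes> y = \<one>"
    and ab: "a \<otimes> b = b \<otimes> a" and ya: "y \<otimes> a = b \<otimes> y" and yb: "y \<otimes> b = (a \<otimes> b) \<otimes> y"
begin

lemma A4_word_rotate:
  "y \<otimes> (a [^] i \<otimes> b [^] j) = (case A4_rot (i, j) of (p, q) \<Rightarrow> a [^] p \<otimes> b [^] q) \<otimes> y"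
proof -
  have yai: "y \<otimes> a [^] i = b [^] i \<otimes> y" for i :: nat
  proof (induction i)
    case (Suc i)
    have "y \<otimes> a [^] Suc i = (y \<otimes> a [^] i) \<otimes> a" using carr by (simp add: m_assoc)
    also have "\<dots> = b [^] i \<otimes> (y \<otimes> a)" using carr Suc by (simp add: m_assoc)
    also have "\<dots> = b [^] Suc i \<otimes> y" using carr ya by (simp add: m_assoc)
    finally show ?case .
  qed (use carr in simp)
  have ybi: "y \<otimes> b [^] j = (a \<otimes> b) [^] j \<otimes> y" for j :: nat
  proof (induction j)
    case (Suc j)
    have "y \<otimes> b [^] Suc j = (y \<otimes> b [^] j) \<otimes> b" using carr by (simp add: m_assoc)
    also have "\<dots> = (a \<otimes> b) [^] j \<otimes> (y \<otimes> b)" using carr Suc by (simp add: m_assoc)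
    also have "\<dots> = (a \<otimes> b) [^] Suc j \<otimes> y" using carr yb by (simp add: m_assoc)
    finally show ?case .
  qed (use carr in simp)
  have "y \<otimes> (a [^] i \<otimes> b [^] j) = (y \<otimes> a [^] i) \<otimes> b [^] j" using carr by (simp add: m_assoc)
  also have "\<dots> = b [^] i \<otimes> (y \<otimes> b [^] j)" using carr yai by (simp add: m_assoc)
  also have "\<dots> = (b [^] i \<otimes> (a \<otimes> b) [^] j) \<otimes> y" using carr ybi by (simp add: m_assoc)
  also have "(a \<otimes> b) [^] j = a [^] j \<otimes> b [^] j"
    by (rule pow_mult_distrib[OF ab carr(1,2)])
  also have "b [^] i \<otimes> (a [^] j \<otimes> b [^] j) = a [^] j \<otimes> (b [^] i \<otimes> b [^] j)"
    using carr pow_commutes_pow[OF carr(2,1) ab[symmetric], of i j]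
    by (simp add: m_assoc[symmetric])
  also have "b [^] i \<otimes> b [^] j = b [^] ((i + j) mod 2)"
    using carr bb pow_mod_if_pow_one[of b 2] by (simp add: nat_pow_mult numeral_2_eq_2)
  finally show ?thesis by simp
qed

lemma A4_word_mult: "A4_word a b y s \<otimes> A4_word a b y t = A4_word a b y (A4_mult s t)"
proof -
  obtain i j k i' j' k' where st: "s = (i, j, k)" "t = (i', j', k')" by (cases s, cases t)
  let ?V = "\<lambda>(p, q). a [^] (p::nat) \<otimes> b [^] (q::nat)"
  have V: "?V r \<in> carrier G" for r using carr by (cases r) simp
  have rot: "y [^] k \<otimes> ?V r = ?V ((A4_rot ^^ k) r) \<otimes> y [^] k" for r k
  proof (induction k)
    case (Suc k)
    have "y [^] Suc k \<otimes> ?V r = y \<otimes> (y [^] k \<otimes> ?V r)"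
      using carr(3) V[of r] by (simp only: nat_pow_Suc2[OF carr(3)] m_assoc nat_pow_closed)
    also have "\<dots> = (y \<otimes> ?V ((A4_rot ^^ k) r)) \<otimes> y [^] k"
      using carr(3) V by (simp only: Suc m_assoc nat_pow_closed)
    also have "y \<otimes> ?V ((A4_rot ^^ k) r) = ?V ((A4_rot ^^ Suc k) r) \<otimes> y"
      using A4_word_rotate by (cases "(A4_rot ^^ k) r") simp
    finally show ?case
      using carr(3) V by (simp only: nat_pow_Suc2[OF carr(3)] m_assoc nat_pow_closed)
  qed (use carr V in simp)
  obtain p q where pq: "(A4_rot ^^ k) (i', j') = (p, q)" by (cases "(A4_rot ^^ k) (i', j')")
  have pow2: "a [^] (n mod 2) = a [^] n" "b [^] (n mod 2) = b [^] n" for n :: nat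
    using carr aa bb by (auto intro!: pow_mod_if_pow_one simp: numeral_2_eq_2)
  have pow3: "y [^] (n mod 3) = y [^] n" for n :: nat
    using carr yyy by (intro pow_mod_if_pow_one) (simp_all add: numeral_3_eq_3)
  have "A4_word a b y s \<otimes> A4_word a b y t = ?V (i, j) \<otimes> ((y [^] k \<otimes> ?V (i', j')) \<otimes> y [^] k')"
    using carr by (simp add: st m_assoc)
  also have "\<dots> = (?V (i, j) \<otimes> ?V (p, q)) \<otimes> (y [^] k \<otimes> y [^] k')"
    using carr rot[of k "(i', j')"] pq by (simp add: m_assoc)
  also have "?V (i, j) \<otimes> ?V (p, q) = a [^] i \<otimes> (b [^] j \<otimes> a [^] p) \<otimes> b [^] q"
    using carr by (simp add: m_assoc)
  also have "b [^] j \<otimes> a [^] p = a [^] p \<otimes> b [^] j"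
    by (rule pow_commutes_pow[OF carr(2,1) ab[symmetric]])
  also have "a [^] i \<otimes> (a [^] p \<otimes> b [^] j) \<otimes> b [^] q = a [^] (i + p) \<otimes> b [^] (j + q)"
    using carr by (simp add: m_assoc nat_pow_mult[symmetric])
  also have "y [^] k \<otimes> y [^] k' = y [^] (k + k')"
    using carr by (simp add: nat_pow_mult)
  finally show ?thesis using pow2 pow3 pq by (simp add: st)
qed

lemma A4_word_closed: "A4_word a b y t \<in> carrier G"
  using carr by (cases t) simp

text \<open>
  It suffices that the kernel is trivial. If \<open>v y ^ k = 1\<close> with \<open>v\<close> in the four-group and \<open>k\<close> not zero,
  then \<open>y ^ k\<close> squares to one, which forces \<open>y = 1\<close> because \<open>y\<close> has order dividing three.
\<close>

lemma inj_A4_word: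
  assumes a1: "a \<noteq> \<one>" and y1: "y \<noteq> \<one>"
  shows "inj_on (A4_word a b y) A4_coords"
proof -
  have b1: "b \<noteq> \<one>"
  proof
    assume "b = \<one>"
    then have "y \<otimes> a = y \<otimes> \<one>" using ya carr by simp
    then show False using a1 carr by simp
  qed
  have ab1: "a \<otimes> b \<noteq> \<one>"
  proof
    assume "a \<otimes> b = \<one>"
    then have "y \<otimes> b = y \<otimes> \<one>" using yb carr by simp
    then show False using b1 carr by simp
  qed
  have ker: "t = (0, 0, 0)" if t: "t \<in> A4_coords" and one: "A4_word a b y t = \<one>" for t
  proof -
    obtain i j k where ijk: "t = (i, j, k)" by (cases t)
    define v where "v = a [^] i \<otimes> b [^] j"
    have v: "v \<in> carrier G" using carr by (simp add: v_def)
    have vv: "v \<otimes> v = \<one>"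
    proof -
      have "v \<otimes> v = A4_word a b y (i, j, 0) \<otimes> A4_word a b y (i, j, 0)"
        using v by (simp add: v_def)
      also have "\<dots> = A4_word a b y (A4_mult (i, j, 0) (i, j, 0))" by (rule A4_word_mult)
      finally show ?thesis using carr by simp
    qed
    have vy: "v \<otimes> y [^] k = \<one>" using one by (simp add: ijk v_def)
    then have "v = v \<otimes> (v \<otimes> y [^] k)" using v by simp
    then have yk: "y [^] k = v" using v carr vv by (simp add: m_assoc[symmetric])
    have "k = 0 \<or> k = 1 \<or> k = 2" using t ijk by (auto simp: A4_coords_def)
    moreover have "k \<noteq> 1"
    proof
      assume "k = 1"
      then have "y \<otimes> y = \<one>" using yk vv carr by simp
      then show False using yyy y1 carr by simp
    qed
    moreover have "k \<noteq> 2"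
    proof
      assume "k = 2"
      then have "v = y \<otimes> y" using yk carr by (simp add: numeral_2_eq_2)
      then have "(y \<otimes> y \<otimes> y) \<otimes> y = \<one>" using vv carr by (simp add: m_assoc)
      then show False using yyy y1 carr by simp
    qed
    ultimately have k: "k = 0" by simp
    then have "v = \<one>" using yk by simp
    then show ?thesis
      using t a1 b1 ab1 carr k unfolding v_def by (auto simp: ijk A4_coords_def)
  qed
  show ?thesis
  proof (rule inj_onI)
    fix s t assume s: "s \<in> A4_coords" and t: "t \<in> A4_coords"
      and eq: "A4_word a b y s = A4_word a b y t"
    obtain r where r: "r \<in> A4_coords" "A4_mult r s = (0, 0, 0)"
      and r_cancel: "\<And>t. t \<in> A4_coords \<Longrightarrow> A4_mult r t = (0, 0, 0) \<Longrightarrow> t = s"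
      using A4_left_cancel s by blast
    have "A4_word a b y (A4_mult r t) = A4_word a b y (0, 0, 0)"
      using eq by (simp only: A4_word_mult[symmetric] r(2)[symmetric])
    then have "A4_mult r t = (0, 0, 0)"
      using r(1) t A4_mult_closed by (intro ker) simp_all
    then show "s = t" using r_cancel t by blast
  qed
qed

end

end

lemma A4_coordinates_alt_group: "\<exists>w. A4_coordinates (alt_group 4) w"
proof -
  interpret group "alt_group 4" by (rule alt_group_is_group)
  \<comment> \<open>\<open>a = (12)(34)\<close>, \<open>b = (23)(14)\<close> and \<open>y = (123)\<close>\<close>
  let ?a = "transpose 1 2 \<circ> transpose 3 4 :: nat \<Rightarrow> nat"
  let ?b = "transpose 2 3 \<circ> transpose 1 4 :: nat \<Rightarrow> nat"
  let ?y = "transpose 1 2 \<circ> transpose 2 3 :: nat \<Rightarrow> nat"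
  have even: "transpose i j \<circ> transpose k l \<in> carrier (alt_group 4)"
    if "i \<in> {1..4}" "j \<in> {1..4}" "k \<in> {1..4}" "l \<in> {1..4}" "i \<noteq> j" "k \<noteq> l" for i j k l :: nat
    using that
    by (simp add: alt_group_carrier permutes_compose permutes_swap_id evenperm_comp
        permutation_swap_id evenperm_swap)
  have carr: "?a \<in> carrier (alt_group 4)" "?b \<in> carrier (alt_group 4)" "?y \<in> carrier (alt_group 4)"
    by (rule even; simp)+
  let ?w = "A4_word ?a ?b ?y"
  note rels = alt_group_mult alt_group_one fun_eq_iff transpose_def
  have rel: "?a \<otimes>\<^bsub>alt_group 4\<^esub> ?a = \<one>\<^bsub>alt_group 4\<^esub>" "?b \<otimes>\<^bsub>alt_group 4\<^esub> ?b = \<one>\<^bsub>alt_group 4\<^esub>"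
    "?y \<otimes>\<^bsub>alt_group 4\<^esub> ?y \<otimes>\<^bsub>alt_group 4\<^esub> ?y = \<one>\<^bsub>alt_group 4\<^esub>"
    "?a \<otimes>\<^bsub>alt_group 4\<^esub> ?b = ?b \<otimes>\<^bsub>alt_group 4\<^esub> ?a"
    "?y \<otimes>\<^bsub>alt_group 4\<^esub> ?a = ?b \<otimes>\<^bsub>alt_group 4\<^esub> ?y"
    "?y \<otimes>\<^bsub>alt_group 4\<^esub> ?b = (?a \<otimes>\<^bsub>alt_group 4\<^esub> ?b) \<otimes>\<^bsub>alt_group 4\<^esub> ?y"
    by (simp_all add: rels)
  have "?a 1 \<noteq> id 1" "?y 1 \<noteq> id 1" by (simp_all add: transpose_def)
  then have "?a \<noteq> \<one>\<^bsub>alt_group 4\<^esub>" "?y \<noteq> \<one>\<^bsub>alt_group 4\<^esub>"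
    unfolding alt_group_one by metis+
  then have inj: "inj_on ?w A4_coords" by (rule inj_A4_word[OF carr rel])
  have "2 * card (carrier (alt_group 4)) = fact 4" by (rule alt_group_card_carrier) simp
  then have card: "card (carrier (alt_group 4)) = 12" by (simp add: fact_numeral)
  have "?w ` A4_coords = carrier (alt_group 4)"
  proof (rule card_seteq)
    show "finite (carrier (alt_group 4))" using card by (metis card.infinite zero_neq_numeral)
    show "?w ` A4_coords \<subseteq> carrier (alt_group 4)"
      using A4_word_closed[OF carr rel] by blast
    show "card (carrier (alt_group 4)) \<le> card (?w ` A4_coords)"
      unfolding card card_image[OF inj] card_A4_coords by (rule order_refl)
  qed
  then have "A4_coordinates (alt_group 4) ?w"
    unfolding A4_coordinates_def bij_betw_def using inj A4_word_mult[OF carr rel] by blast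
  then show ?thesis by blast
qed

section \<open>F-groups with trivial center\<close>

locale centerless_F_group = group +
  assumes finite_carrier: "finite (carrier G)"
    and F_group: "F_group G"
    and center_trivial: "center G = {\<one>}"
begin

text \<open>
  With trivial center, nontrivial elements of \<open>bicentralizer x\<close> all share the centralizer of \<open>x\<close>. So the
  bicentralizers partition the nonidentity elements, and the blocks are the fibers of the centralizer
  map. In particular a nontrivial power of \<open>x\<close> has the same centralizer as \<open>x\<close>.
\<close>

lemma centralizer_eq_if_bicentralizer:
  assumes x: "x \<in> carrier G" and y: "y \<in> bicentralizer x" "y \<noteq> \<one>"
  shows "centralizer G y = centralizer G x"
proof -
  have yG: "y \<in> carrier G" and le: "centralizer G x \<subseteq> centralizer G y"
    using y by (simp_all add: bicentralizer_def)
  have "x \<noteq> \<one>"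
  proof
    assume "x = \<one>"
    then have "centralizer G x = carrier G"
      using centralizer_eq_carrier_iff[OF x] one_in_center by simp
    then have "y \<in> center G"
      using le centralizer_eq_carrier_iff[OF yG] by (auto simp: centralizer_def)
    then show False using y center_trivial by simp
  qed
  then show ?thesis
    using F_group x yG y(2) le center_trivial unfolding F_group_def by blast
qed

lemma centralizer_proper:
  assumes "x \<in> carrier G" "x \<noteq> \<one>"
  shows "centralizer G x \<noteq> carrier G"
  using assms centralizer_eq_carrier_iff center_trivial by simp

lemma bicentralizer_eq:
  assumes x: "x \<in> carrier G" "x \<noteq> \<one>"
  shows "bicentralizer x = insert \<one> {y \<in> carrier G - {\<one>}. centralizer G y = centralizer G x}"
proof
  show "bicentralizer x \<subseteq> insert \<one> {y \<in> carrier G - {\<one>}. centralizer G y = centralizer G x}"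
    using centralizer_eq_if_bicentralizer[OF x(1)] subgroup.subset[OF subgroup_bicentralizer[OF x(1)]]
    by blast
  show "insert \<one> {y \<in> carrier G - {\<one>}. centralizer G y = centralizer G x} \<subseteq> bicentralizer x"
    using subgroup.one_closed[OF subgroup_bicentralizer[OF x(1)]] by (auto simp: bicentralizer_def)
qed

text \<open>
  Here \<open>x\<close> is an involution, as \<open>x x\<close> lies in \<open>bicentralizer x\<close>. If \<open>y\<close> commutes with \<open>x\<close> but is not an
  involution, then \<open>x y\<close> and \<open>y\<close> have the same nontrivial square, hence the same centralizer, which then
  also centralizes their quotient \<open>x\<close>; so \<open>y\<close> would be in the fiber of \<open>x\<close>. Therefore \<open>C(x)\<close> has
  exponent two and is abelian, and all its nontrivial elements share the centralizer of \<open>x\<close>.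
\<close>

lemma centralizer_pair_if_singleton_fiber:
  assumes x: "x \<in> carrier G" "x \<noteq> \<one>"
    and fiber: "{y \<in> carrier G - {\<one>}. centralizer G y = centralizer G x} = {x}"
  shows "centralizer G x = {\<one>, x}"
proof -
  have bi: "bicentralizer x = {\<one>, x}" using bicentralizer_eq[OF x] fiber by simp
  have "x \<otimes> x \<in> {\<one>, x}"
    using subgroup.m_closed[OF subgroup_bicentralizer[OF x(1)]] bi by blast
  then have xx: "x \<otimes> x = \<one>" using x by auto
  have sq: "y \<otimes> y = \<one>" if y: "y \<in> centralizer G x" for y
  proof (rule ccontr)
    assume yy: "y \<otimes> y \<noteq> \<one>"
    have yG: "y \<in> carrier G" using y by (rule centralizer_carrier)
    have y1: "y \<noteq> \<one>" using yy by auto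
    have "(x \<otimes> y) \<otimes> (x \<otimes> y) = (x \<otimes> (y \<otimes> x)) \<otimes> y" using x(1) yG by (simp add: m_assoc)
    also have "\<dots> = (x \<otimes> x) \<otimes> (y \<otimes> y)"
      using x(1) yG by (simp only: centralizerD[OF y] m_assoc m_closed)
    finally have xyxy: "(x \<otimes> y) \<otimes> (x \<otimes> y) = y \<otimes> y" using xx yG by simp
    have sq_in: "u \<otimes> u \<in> bicentralizer u" if "u \<in> carrier G" for u
      using subgroup.m_closed[OF subgroup_bicentralizer[OF that]] self_in_bicentralizer[OF that] by blast
    have "centralizer G (x \<otimes> y) = centralizer G (y \<otimes> y)"
      using centralizer_eq_if_bicentralizer[OF _ sq_in[of "x \<otimes> y"]] xyxy yy x(1) yG by simp
    also have "\<dots> = centralizer G y"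
      using centralizer_eq_if_bicentralizer[OF yG sq_in[OF yG] yy] .
    finally have eq: "x \<otimes> y \<in> bicentralizer y" using x(1) yG by (simp add: bicentralizer_def)
    have "(x \<otimes> y) \<otimes> inv y \<in> bicentralizer y"
      using subgroup.m_closed[OF subgroup_bicentralizer[OF yG] eq]
        subgroup.m_inv_closed[OF subgroup_bicentralizer[OF yG] self_in_bicentralizer[OF yG]] by blast
    then have "x \<in> bicentralizer y" using x(1) yG by (simp add: m_assoc)
    then have "centralizer G y = centralizer G x"
      using centralizer_eq_if_bicentralizer[OF yG _ x(2)] by simp
    then have "y \<in> {x}" using fiber yG y1 by blast
    then show False using yy xx by simp
  qed
  show ?thesis
  proof
    show "{\<one>, x} \<subseteq> centralizer G x"
      using self_in_centralizer[OF x(1)] subgroup.one_closed[OF subgroup_centralizer[OF x(1)]] by blast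
    show "centralizer G x \<subseteq> {\<one>, x}"
    proof
      fix y assume y: "y \<in> centralizer G x"
      have yG: "y \<in> carrier G" using y by (rule centralizer_carrier)
      have "centralizer G x \<subseteq> centralizer G y"
      proof
        fix u assume u: "u \<in> centralizer G x"
        show "u \<in> centralizer G y"
          using abelian_if_squares_one[OF subgroup_centralizer[OF x(1)] sq u y] centralizer_carrier[OF u]
          by (intro centralizerI)
      qed
      then have "y \<in> bicentralizer x" using yG by (simp add: bicentralizer_def)
      then show "y \<in> {\<one>, x}" using bi by simp
    qed
  qed
qed

lemma pow_card_bicentralizer:
  assumes x: "x \<in> carrier G" and y: "y \<in> bicentralizer x"
  shows "y [^] card (bicentralizer x) = \<one>"
proof -
  note sub = subgroup_bicentralizer[OF x]
  interpret B: group "G\<lparr>carrier := bicentralizer x\<rparr>" by (rule subgroup_imp_group[OF sub])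
  have "finite (bicentralizer x)"
    using subgroup.subset[OF sub] finite_carrier by (rule finite_subset)
  then show ?thesis
    using B.pow_order_eq_1[of y] y by (simp add: order_def nat_pow_consistent[symmetric])
qed

text \<open>
  By \<open>centralizer_pair_if_singleton_fiber\<close> all fibers of the centralizer map on the
  nonidentity elements have at least two elements, and the bound on the number of centralizers leaves
  room for at most one more element. If all fibers had exactly two, all bicentralizers would have order three and the group would be a 3-group,
  which has a nontrivial center. So exactly one fiber has three elements and all others have two.
\<close>

lemma order_4_bicentralizer_if_many_centralizers:
  assumes nonab: "\<not> comm_group G" and many: "order G \<le> 2 * card (Cent G)"
    and no_pair: "\<And>x. x \<in> carrier G \<Longrightarrow> x \<noteq> \<one> \<Longrightarrow> centralizer G x \<noteq> {\<one>, x}"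
  obtains v where "v \<in> carrier G" "v \<noteq> \<one>" "card (bicentralizer v) = 4"
    "\<And>y. y \<in> carrier G - bicentralizer v \<Longrightarrow> y [^] (3::nat) = \<one>"
proof -
  let ?A = "carrier G - {\<one>}"
  let ?C = "centralizer G"
  let ?F = "\<lambda>c. {y \<in> ?A. ?C y = c}"
  have finA: "finite ?A" using finite_carrier by simp
  have ge2: "2 \<le> card (?F c)" if c: "c \<in> ?C ` ?A" for c
  proof (rule ccontr)
    obtain x where x: "x \<in> carrier G" "x \<noteq> \<one>" "c = ?C x" using c by blast
    assume "\<not> 2 \<le> card (?F c)"
    moreover have xF: "x \<in> ?F c" using x by simp
    ultimately have "card (?F c) = 1"
      using finA card_gt_0_iff[of "?F c"] by fastforce
    then have "?F c = {x}" using xF by (metis card_1_singletonE singletonD)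
    then show False
      using centralizer_pair_if_singleton_fiber[OF x(1,2)] no_pair[OF x(1,2)] x(3) by simp
  qed
  have "?C \<one> = carrier G"
    using centralizer_eq_carrier_iff[OF one_closed] one_in_center by simp
  then have "Cent G = insert (carrier G) (?C ` ?A)"
    unfolding Cent_def by (metis image_insert insert_Diff one_closed)
  moreover have "carrier G \<notin> ?C ` ?A" using centralizer_proper by blast
  ultimately have cardC: "card (Cent G) = Suc (card (?C ` ?A))" using finA by simp
  have cardA: "card ?A = order G - 1" by (simp add: order_def card_Diff_singleton)
  have excess: "(\<Sum>c\<in>?C ` ?A. card (?F c) - 2) \<le> 1"
    using fiber_excess[where f = ?C and k = 2, OF finA ge2] many cardC cardA by linarith
  have card_bi: "card (bicentralizer x) = Suc (card (?F (?C x)))" if "x \<in> carrier G" "x \<noteq> \<one>" for x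
    using bicentralizer_eq[OF that] finA by simp
  have cube: "y [^] (3::nat) = \<one>" if y: "y \<in> carrier G" "y \<noteq> \<one>" "card (?F (?C y)) = 2" for y
    using pow_card_bicentralizer[OF y(1) self_in_bicentralizer[OF y(1)]] card_bi[OF y(1,2)] y(3)
    by (simp add: numeral_3_eq_3 numeral_2_eq_2 del: nat_pow_Suc)
  have "\<exists>v \<in> ?A. card (?F (?C v)) \<noteq> 2"
  proof (rule ccontr)
    assume "\<not> (\<exists>v \<in> ?A. card (?F (?C v)) \<noteq> 2)"
    then have cubes: "y [^] ((3::nat) ^ 1) = \<one>" if "y \<in> carrier G" for y
      using cube[of y] that by (cases "y = \<one>") simp_all
    have "Factorial_Ring.prime (3::nat)" by simp
    from order_prime_power_if_exponent_prime_power[OF this finite_carrier cubes]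
    obtain n where n: "order G = 3 ^ n" by blast
    have "n \<noteq> 0"
    proof
      assume "n = 0"
      then obtain e where e: "carrier G = {e}" using n by (auto simp: order_def card_1_singleton_iff)
      have "comm_group G"
        by (rule group_comm_groupI) (use e in simp)
      then show False using nonab by blast
    qed
    then show False
      using prime_power_group_center_nontrivial[of 3 n] n center_trivial by simp
  qed
  then obtain v where v: "v \<in> carrier G" "v \<noteq> \<one>" "card (?F (?C v)) \<noteq> 2" by blast
  have vC: "?C v \<in> ?C ` ?A" using v by blast
  have v3: "3 \<le> card (?F (?C v))" using ge2[OF vC] v(3) by linarith
  \<comment> \<open>Applied to one fiber this bounds its size; applied to two it excludes a second large one.\<close>
  have pair_sum: "(\<Sum>c\<in>S. card (?F c) - 2) \<le> 1" if "S \<subseteq> ?C ` ?A" for S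
    using sum_mono2[OF finite_imageI[OF finA] that, of "\<lambda>c. card (?F c) - 2"] excess by simp
  have "card (?F (?C v)) \<le> 3" using pair_sum[of "{?C v}"] vC by simp
  with v3 have "card (bicentralizer v) = 4" using card_bi[OF v(1,2)] by simp
  moreover have "y [^] (3::nat) = \<one>" if y: "y \<in> carrier G - bicentralizer v" for y
  proof (rule cube)
    show yG: "y \<in> carrier G" and y1: "y \<noteq> \<one>"
      using y subgroup.one_closed[OF subgroup_bicentralizer[OF v(1)]] by auto
    have "?C y \<noteq> ?C v" using y by (auto simp: bicentralizer_def)
    moreover have yC: "?C y \<in> ?C ` ?A" using yG y1 by blast
    ultimately have "(card (?F (?C y)) - 2) + (card (?F (?C v)) - 2) \<le> 1"
      using pair_sum[of "{?C y, ?C v}"] vC by simp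
    then show "card (?F (?C y)) = 2" using v3 ge2[OF yC] by linarith
  qed
  ultimately show thesis using that v by blast
qed

text \<open>
  Let \<open>V\<close> be the bicentralizer of order four. As elements of \<open>V\<close> have order dividing four and all others
  have order three, \<open>V\<close> is normal. An involution \<open>a\<close> of \<open>V\<close> has centralizer \<open>V\<close>: an element \<open>z\<close> outside
  commuting with \<open>a\<close> would give \<open>(z a) ^ 3 = a\<close>. Hence an element \<open>y\<close> outside \<open>V\<close> permutes the three
  involutions of \<open>V\<close> cyclically. Every \<open>g\<close> conjugates \<open>a\<close> as some power of \<open>y\<close> does, so \<open>V\<close> and \<open>y\<close> generate
  the group.
\<close>

lemma A4_coordinates_if_order_4_bicentralizer:
  assumes nonab: "\<not> comm_group G" and v: "v \<in> carrier G" "v \<noteq> \<one>"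
    and card: "card (bicentralizer v) = 4"
    and cube: "\<And>y. y \<in> carrier G - bicentralizer v \<Longrightarrow> y [^] (3::nat) = \<one>"
  shows "\<exists>w. A4_coordinates G w"
proof -
  define V where "V = bicentralizer v"
  have V: "subgroup V G" unfolding V_def by (rule subgroup_bicentralizer[OF v(1)])
  note VG = subgroup.mem_carrier[OF V]
  have pow4: "u [^] (4::nat) = \<one>" if "u \<in> V" for u
    using pow_card_bicentralizer[OF v(1), of u] that card by (simp add: V_def)
  have Vcomm: "u \<otimes> u' = u' \<otimes> u" if u: "u \<in> V" "u' \<in> V" for u u'
  proof -
    have "v \<in> centralizer G u'" using u(2) self_in_centralizer[OF v(1)] by (auto simp: V_def bicentralizer_def)
    then have "u' \<in> centralizer G v" using centralizer_sym[OF VG[OF u(2)]] by blast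
    then have "u' \<in> centralizer G u" using u(1) by (auto simp: V_def bicentralizer_def)
    from centralizerD[OF this] show ?thesis by (rule sym)
  qed
  have vV: "v \<in> V" unfolding V_def by (rule self_in_bicentralizer[OF v(1)])
  obtain a where a: "a \<in> V" "a \<noteq> \<one>" "a \<otimes> a = \<one>"
  proof (cases "v \<otimes> v = \<one>")
    case True
    with vV v(2) that show thesis by blast
  next
    case False
    have "(v \<otimes> v) \<otimes> (v \<otimes> v) = v [^] (4::nat)"
      using v(1) by (simp add: eval_nat_numeral m_assoc)
    then have "(v \<otimes> v) \<otimes> (v \<otimes> v) = \<one>" using pow4[OF vV] by simp
    with False that show thesis using subgroup.m_closed[OF V vV vV] by blast
  qed
  have aG: "a \<in> carrier G" by (rule VG[OF a(1)])
  have Ca: "centralizer G a = V"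
  proof
    show "V \<subseteq> centralizer G a" using Vcomm[OF _ a(1)] VG by (blast intro: centralizerI)
    show "centralizer G a \<subseteq> V"
    proof (rule subsetI, rule ccontr)
      fix z assume z: "z \<in> centralizer G a" "z \<notin> V"
      have zG: "z \<in> carrier G" using z(1) by (rule centralizer_carrier)
      have "z \<otimes> a \<notin> V"
      proof
        assume "z \<otimes> a \<in> V"
        then have "(z \<otimes> a) \<otimes> a \<in> V" using subgroup.m_closed[OF V _ a(1)] by blast
        then show False using z(2) zG aG a(3) by (simp add: m_assoc)
      qed
      then have "(z \<otimes> a) [^] (3::nat) = \<one>" using cube zG aG by (simp add: V_def)
      moreover have "z [^] (3::nat) = \<one>" using cube zG z(2) by (simp add: V_def)
      moreover have "(z \<otimes> a) [^] (3::nat) = z [^] (3::nat) \<otimes> a [^] (3::nat)"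
        by (rule pow_mult_distrib[OF centralizerD[OF z(1)] zG aG])
      moreover have "a [^] (3::nat) = a" using aG a(3) by (simp add: numeral_3_eq_3)
      ultimately show False using a(2) aG by simp
    qed
  qed
  have normal: "g \<otimes> u \<otimes> inv g \<in> V" if g: "g \<in> carrier G" and u: "u \<in> V" for g u
  proof (rule ccontr)
    have uG: "u \<in> carrier G" by (rule VG[OF u])
    assume out: "g \<otimes> u \<otimes> inv g \<notin> V"
    have gg: "inv g \<otimes> (g \<otimes> x) = x" if "x \<in> carrier G" for x
      using that g by (simp add: m_assoc[symmetric])
    have "(g \<otimes> u \<otimes> inv g) [^] (3::nat) = \<one>" using cube out g uG by (simp add: V_def)
    moreover have "inv g \<otimes> ((g \<otimes> u \<otimes> inv g) [^] (3::nat) \<otimes> g) = u [^] (3::nat)"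
      using g uG by (simp add: numeral_3_eq_3 m_assoc gg)
    ultimately have "inv g \<otimes> (\<one> \<otimes> g) = u [^] (3::nat)" by (simp only:)
    then have "u [^] (3::nat) = \<one>" using g by simp
    moreover have "u [^] (4::nat) = u [^] (3::nat) \<otimes> u" by (simp add: eval_nat_numeral)
    ultimately have "u = \<one>" using pow4[OF u] uG by simp
    then show False using out g subgroup.one_closed[OF V] by simp
  qed
  have "V \<noteq> carrier G"
  proof
    assume eq: "V = carrier G"
    have "comm_group G" by (rule group_comm_groupI) (rule Vcomm, simp_all add: eq)
    then show False using nonab by blast
  qed
  then obtain y where y: "y \<in> carrier G" "y \<notin> V" using VG by blast
  have y3: "y \<otimes> y \<otimes> y = \<one>" using cube[of y] y by (simp add: V_def numeral_3_eq_3)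
  \<comment> \<open>Conjugation by \<open>y\<close> acts on the nonidentity elements of \<open>V\<close> as the cycle \<open>(a b c)\<close>.\<close>
  define \<phi> where "\<phi> = (\<lambda>u. y \<otimes> u \<otimes> inv y)"
  have \<phi>V: "\<phi> u \<in> V" if "u \<in> V" for u using normal[OF y(1) that] by (simp add: \<phi>_def)
  have \<phi>_inj: "u = u'" if "\<phi> u = \<phi> u'" "u \<in> V" "u' \<in> V" for u u'
    using that VG y(1) by (simp add: \<phi>_def)
  have \<phi>1: "\<phi> \<one> = \<one>" using y(1) by (simp add: \<phi>_def)
  define b where "b = \<phi> a"
  define c where "c = \<phi> b"
  have bV: "b \<in> V" and cV: "c \<in> V" using \<phi>V a(1) by (simp_all add: b_def c_def)
  note bG = VG[OF bV] and cG = VG[OF cV]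
  have c_conj: "c = (y \<otimes> y) \<otimes> a \<otimes> inv (y \<otimes> y)"
    using y(1) aG by (simp add: c_def b_def \<phi>_def m_assoc inv_mult_group)
  have \<phi>c: "\<phi> c = a"
  proof -
    have "\<phi> c = (y \<otimes> y \<otimes> y) \<otimes> a \<otimes> inv (y \<otimes> y \<otimes> y)"
      using y(1) aG by (simp add: c_conj \<phi>_def m_assoc inv_mult_group)
    then show ?thesis using y3 aG by simp
  qed
  have b_a: "b \<noteq> a"
  proof
    assume "b = a"
    then have "inv \<one> \<otimes> y \<in> centralizer G a"
      using conj_eq_conj_iff[OF one_closed y(1) aG] aG by (simp add: b_def \<phi>_def)
    then show False using Ca y by simp
  qed
  have c_b: "c \<noteq> b" using b_a \<phi>_inj[OF _ bV a(1)] by (auto simp: c_def b_def)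
  have c_a: "c \<noteq> a" using b_a \<phi>c by (auto simp: b_def)
  have oneV: "\<one> \<in> V" by (rule subgroup.one_closed[OF V])
  have b1: "b \<noteq> \<one>" using a(2) \<phi>_inj[OF _ a(1) oneV] \<phi>1 by (auto simp: b_def)
  have c1: "c \<noteq> \<one>" using b1 \<phi>_inj[OF _ bV oneV] \<phi>1 by (auto simp: c_def)
  have Veq: "V = {\<one>, a, b, c}"
  proof (rule card_seteq[symmetric])
    show "finite V" using card by (metis V_def card.infinite zero_neq_numeral)
    show "{\<one>, a, b, c} \<subseteq> V" using oneV a(1) bV cV by simp
    show "card V \<le> card {\<one>, a, b, c}" using card a(2) b1 c1 b_a c_a c_b by (simp add: V_def eq_commute)
  qed
  have bb: "b \<otimes> b = \<one>"
  proof -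
    have "inv y \<otimes> (y \<otimes> x) = x" if "x \<in> carrier G" for x
      using that y(1) by (simp add: m_assoc[symmetric])
    then have "b \<otimes> b = \<phi> (a \<otimes> a)" using y(1) aG by (simp add: b_def \<phi>_def m_assoc)
    then show ?thesis using a(3) \<phi>1 by simp
  qed
  have ab: "a \<otimes> b = c"
  proof -
    have "a \<otimes> b \<in> V" by (rule subgroup.m_closed[OF V a(1) bV])
    moreover have "a \<otimes> b \<noteq> \<one>" using a(3) b_a aG bG by (metis l_cancel)
    moreover have "a \<otimes> b \<noteq> a" "a \<otimes> b \<noteq> b" using b1 a(2) aG bG by simp_all
    ultimately show ?thesis using Veq by blast
  qed
  have ya: "y \<otimes> a = b \<otimes> y" using y(1) aG by (simp add: b_def \<phi>_def m_assoc)
  have yb: "y \<otimes> b = (a \<otimes> b) \<otimes> y" using y(1) bG by (simp add: ab c_def \<phi>_def m_assoc)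
  note rels = aG bG y(1) a(3) bb y3 Vcomm[OF a(1) bV] ya yb
  let ?w = "A4_word a b y"
  have y1: "y \<noteq> \<one>" using y(2) oneV by blast
  have inj: "inj_on ?w A4_coords" by (rule inj_A4_word[OF rels a(2) y1])
  have word: "u \<otimes> y [^] k \<in> ?w ` A4_coords" if u: "u \<in> V" and k: "k \<in> {0, 1, 2}" for u and k :: nat
  proof -
    have i: "?w (i, j, k) \<in> ?w ` A4_coords" if "i \<in> {0, 1}" "j \<in> {0, 1}" for i j
      using that k unfolding A4_coords_def by (intro imageI SigmaI)
    have yk: "y [^] k \<in> carrier G" using y(1) by simp
    consider "u = \<one>" | "u = a" | "u = b" | "u = c" using u Veq by blast
    then show ?thesis
    proof cases
      case 1
      then show ?thesis using i[of 0 0] yk by simp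
    next
      case 2
      then show ?thesis using i[of 1 0] yk aG by simp
    next
      case 3
      then show ?thesis using i[of 0 1] yk bG by simp
    next
      case 4
      then show ?thesis using i[of 1 1] yk aG bG ab by simp
    qed
  qed
  have surj: "?w ` A4_coords = carrier G"
  proof
    show "?w ` A4_coords \<subseteq> carrier G" using A4_word_closed[OF rels] by blast
    show "carrier G \<subseteq> ?w ` A4_coords"
    proof
      fix g assume g: "g \<in> carrier G"
      have "g \<otimes> a \<otimes> inv g \<in> V" by (rule normal[OF g a(1)])
      moreover have "g \<otimes> a \<otimes> inv g \<noteq> \<one>"
      proof
        assume one: "g \<otimes> a \<otimes> inv g = \<one>"
        have "g \<otimes> a = (g \<otimes> a \<otimes> inv g) \<otimes> g" using g aG by (simp add: m_assoc)
        then show False using one g aG a(2) by simp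
      qed
      ultimately have cases: "g \<otimes> a \<otimes> inv g \<in> {a, b, c}" using Veq by blast
      have "a = y [^] (0::nat) \<otimes> a \<otimes> inv (y [^] (0::nat))" using aG by simp
      moreover have "b = y [^] (1::nat) \<otimes> a \<otimes> inv (y [^] (1::nat))"
        using y(1) by (simp add: b_def \<phi>_def)
      moreover have "c = y [^] (2::nat) \<otimes> a \<otimes> inv (y [^] (2::nat))"
        using y(1) by (simp add: c_conj numeral_2_eq_2)
      ultimately obtain k :: nat where k: "k \<in> {0, 1, 2}"
        "g \<otimes> a \<otimes> inv g = y [^] k \<otimes> a \<otimes> inv (y [^] k)"
        using cases by (metis insertCI insertE singletonD)
      define z where "z = y [^] k"
      have zG: "z \<in> carrier G" using y(1) by (simp add: z_def)
      have "inv z \<otimes> g \<in> V" using k(2) conj_eq_conj_iff[OF zG g aG] Ca by (simp add: z_def)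
      then have "z \<otimes> (inv z \<otimes> g) \<otimes> inv z \<in> V" by (rule normal[OF zG])
      then have "g \<otimes> inv z \<in> V" using zG g by (simp add: m_assoc[symmetric])
      from word[OF this k(1)] show "g \<in> ?w ` A4_coords"
        using zG g by (simp add: z_def[symmetric] m_assoc)
    qed
  qed
  have "A4_coordinates G ?w"
    unfolding A4_coordinates_def bij_betw_def using inj surj A4_word_mult[OF rels] by blast
  then show ?thesis by blast
qed

end

section \<open>The characterization\<close>

context group
begin

text \<open>
  Commutators lie in \<open>{1, z}\<close>. So two elements that both fail to commute with \<open>x\<close> have a product that
  does commute with \<open>x\<close>, proper centralizers have index two, and no two of them are strictly nested.
  Likewise, if \<open>x\<close> and \<open>y\<close> have the same centralizer, then each \<open>g\<close> commutes with both or picks up the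
  factor \<open>z\<close> with both, hence commutes with \<open>inv x y\<close>; thus the fibers of the centralizer map have at
  most two elements.
\<close>

lemma F_group_many_centralizers_if_extraspecial:
  assumes es: "extraspecial 2 G"
  shows "F_group G" and "order G \<le> 2 * card (Cent G)"
proof -
  have fin: "finite (carrier G)" and derived: "derived G (carrier G) = center G"
    and card: "card (center G) = 2"
    using es by (simp_all add: extraspecial_def)
  obtain p q where "center G = {p, q}" "p \<noteq> q" using card by (auto simp: card_2_iff)
  then obtain z where z: "center G = {\<one>, z}" "z \<noteq> \<one>"
    using one_in_center by (metis insertE insert_commute singletonD)
  have zZ: "z \<in> center G" using z(1) by simp
  have zG: "z \<in> carrier G" by (rule centerD(1)[OF zZ])
  have "z \<otimes> z \<in> {\<one>, z}" using subgroup.m_closed[OF subgroup_center zZ zZ] z(1) by blast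
  then have zz: "z \<otimes> z = \<one>" using z(2) zG by auto
  have comm: "g \<otimes> x = z \<otimes> (x \<otimes> g)" if xg: "x \<in> carrier G" "g \<in> carrier G" "g \<notin> centralizer G x" for x g
  proof -
    have "g \<otimes> x \<otimes> inv g \<otimes> inv x \<in> {\<one>, z}"
      unfolding z(1)[symmetric] derived[symmetric] derived_def
      using xg by (intro generate.incl) blast
    moreover have "g \<otimes> x = (g \<otimes> x \<otimes> inv g \<otimes> inv x) \<otimes> (x \<otimes> g)"
    proof -
      have "inv x \<otimes> (x \<otimes> g) = g" using xg by (simp add: m_assoc[symmetric])
      then show ?thesis using xg by (simp add: m_assoc)
    qed
    moreover have "g \<otimes> x \<noteq> x \<otimes> g" using xg by (simp add: centralizer_def)
    ultimately show ?thesis using xg by (metis insertE l_one m_closed singletonD)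
  qed
  have prod: "g \<otimes> h \<in> centralizer G x"
    if x: "x \<in> carrier G" and g: "g \<in> carrier G" "g \<notin> centralizer G x"
      and h: "h \<in> carrier G" "h \<notin> centralizer G x" for x g h
  proof (rule centralizerI)
    have "(g \<otimes> h) \<otimes> x = g \<otimes> (z \<otimes> (x \<otimes> h))" using comm[OF x h] x g h by (simp add: m_assoc)
    also have "\<dots> = z \<otimes> ((g \<otimes> x) \<otimes> h)"
    proof -
      have "g \<otimes> (z \<otimes> (x \<otimes> h)) = (g \<otimes> z) \<otimes> (x \<otimes> h)" using x g h zG by (simp add: m_assoc)
      also have "g \<otimes> z = z \<otimes> g" by (rule centerD(2)[OF zZ g(1), symmetric])
      finally show ?thesis using x g h zG by (simp add: m_assoc)
    qed
    also have "\<dots> = (z \<otimes> z) \<otimes> (x \<otimes> (g \<otimes> h))" using comm[OF x g] x g h zG by (simp add: m_assoc)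
    finally show "(g \<otimes> h) \<otimes> x = x \<otimes> (g \<otimes> h)" using zz x g h by simp
  qed (use g h in simp)
  have "centralizer G x = centralizer G y"
    if x: "x \<in> carrier G - center G" and y: "y \<in> carrier G - center G"
      and le: "centralizer G x \<subseteq> centralizer G y" for x y
  proof (rule ccontr)
    assume "centralizer G x \<noteq> centralizer G y"
    then obtain g where g: "g \<in> centralizer G y" "g \<notin> centralizer G x" using le by blast
    have "centralizer G y \<noteq> carrier G" using y centralizer_eq_carrier_iff by blast
    then obtain h where h: "h \<in> carrier G" "h \<notin> centralizer G y"
      by (auto dest: centralizer_carrier)
    have gG: "g \<in> carrier G" by (rule centralizer_carrier[OF g(1)])
    have "g \<otimes> h \<in> centralizer G y" using prod[of x g h] x gG g(2) h le by blast
    moreover have sub: "subgroup (centralizer G y) G" using y by (intro subgroup_centralizer) simp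
    ultimately have "inv g \<otimes> (g \<otimes> h) \<in> centralizer G y"
      using g(1) subgroup.m_closed subgroup.m_inv_closed by metis
    then show False using h gG by (simp add: m_assoc[symmetric])
  qed
  then show "F_group G" unfolding F_group_def using group_axioms by blast
  show "order G \<le> 2 * card (Cent G)"
    unfolding order_def Cent_def
  proof (rule card_le_mult_card_image[OF fin])
    fix c assume "c \<in> centralizer G ` carrier G"
    then obtain x where x: "x \<in> carrier G" "c = centralizer G x" by blast
    have "{y \<in> carrier G. centralizer G y = c} \<subseteq> {x, x \<otimes> z}"
    proof
      fix y assume "y \<in> {y \<in> carrier G. centralizer G y = c}"
      then have y: "y \<in> carrier G" "centralizer G y = centralizer G x" using x by simp_all
      have "inv x \<otimes> y \<in> center G"
      proof (rule centerI)
        fix g assume g: "g \<in> carrier G"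
        show "(inv x \<otimes> y) \<otimes> g = g \<otimes> (inv x \<otimes> y)"
        proof (cases "g \<in> centralizer G x")
          case True
          then have "g \<in> centralizer G y" using y(2) by simp
          from centralizerD[OF True] centralizerD[OF this] show ?thesis
            using x(1) y(1) g by (intro commutes_mult commutes_inv) simp_all
        next
          case False
          have gx: "g \<otimes> x = z \<otimes> (x \<otimes> g)" by (rule comm[OF x(1) g False])
          have gy: "g \<otimes> y = z \<otimes> (y \<otimes> g)" using comm[OF y(1) g] False y(2) by simp
          have "x \<otimes> (g \<otimes> (inv x \<otimes> y)) = x \<otimes> ((inv x \<otimes> y) \<otimes> g)"
          proof -
            have "z \<otimes> (x \<otimes> (g \<otimes> (inv x \<otimes> y))) = (z \<otimes> (x \<otimes> g)) \<otimes> (inv x \<otimes> y)"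
              using x(1) y(1) g zG by (simp add: m_assoc)
            also have "\<dots> = g \<otimes> (x \<otimes> (inv x \<otimes> y))"
              using x(1) y(1) g by (simp add: gx[symmetric] m_assoc)
            also have "x \<otimes> (inv x \<otimes> y) = y" using x(1) y(1) by (simp add: m_assoc[symmetric])
            also have "g \<otimes> y = z \<otimes> (y \<otimes> g)" by (rule gy)
            finally have "x \<otimes> (g \<otimes> (inv x \<otimes> y)) = y \<otimes> g"
              using x(1) y(1) g zG by simp
            also have "\<dots> = x \<otimes> ((inv x \<otimes> y) \<otimes> g)"
              using x(1) y(1) g by (simp add: m_assoc[symmetric])
            finally show ?thesis .
          qed
          then show ?thesis using x(1) y(1) g by simp
        qed
      qed (use x(1) y(1) in simp)
      then have "inv x \<otimes> y \<in> {\<one>, z}" using z(1) by simp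
      moreover have "y = x \<otimes> (inv x \<otimes> y)" using x(1) y(1) by (simp add: m_assoc[symmetric])
      ultimately show "y \<in> {x, x \<otimes> z}" using x(1) by auto
    qed
    then have "card {y \<in> carrier G. centralizer G y = c} \<le> card {x, x \<otimes> z}"
      by (intro card_mono) simp_all
    also have "\<dots> \<le> 2" by (simp add: card_insert_if)
    finally show "card {y \<in> carrier G. centralizer G y = c} \<le> 2" .
  qed
qed

text \<open>
  The order of the center decides between the extraspecial case and the centerless one, and in the
  latter the existence of a self-centralizing involution decides between Frobenius groups and the
  alternating group.
\<close>

lemma cases_if_F_group_many_centralizers:
  assumes fin: "finite (carrier G)" and nonab: "\<not> comm_group G"
    and F: "F_group G" and many: "order G \<le> 2 * card (Cent G)"
  shows "G \<cong> alt_group 4 \<or> extraspecial 2 G \<or>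
     (\<exists>H. frobenius_complement G H \<and> card H = 2 \<and>
          comm_group (G\<lparr>carrier := frobenius_kernel G H\<rparr>))"
proof -
  have "card (center G) * card (Cent G) \<le> 2 * card (Cent G)"
    using card_center_mult_card_Cent_le[OF fin] many by linarith
  moreover have "order G > 0" using fin order_gt_0_iff_finite by blast
  ultimately have le2: "card (center G) \<le> 2" using many by simp
  have finZ: "finite (center G)" using fin by (simp add: center_def)
  show ?thesis
  proof (cases "card (center G) = 2")
    case True
    then have "extraspecial 2 G"
      using squares_central_if_card_Cent_eq_index[OF fin] many fin nonab
      by (intro extraspecial_if_squares_central) simp_all
    then show ?thesis by blast
  next
    case False
    have "{\<one>} = center G"
    proof (rule card_seteq[OF finZ])
      show "{\<one>} \<subseteq> center G" using one_in_center by simp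
      have "card (center G) \<le> 1" using False le2 by linarith
      then show "card (center G) \<le> card {\<one>}" by simp
    qed
    then interpret centerless_F_group G
      by unfold_locales (use F fin in simp_all)
    show ?thesis
    proof (cases "\<exists>h \<in> carrier G. h \<noteq> \<one> \<and> centralizer G h = {\<one>, h}")
      case True
      then obtain h where h: "h \<in> carrier G" "h \<noteq> \<one>" "centralizer G h = {\<one>, h}" by blast
      moreover have "card {\<one>, h} = 2" using h(2) by (simp add: card_insert_if)
      ultimately show ?thesis using frobenius_if_centralizer_pair[OF fin nonab h] by blast
    next
      case False
      then obtain v where "v \<in> carrier G" "v \<noteq> \<one>" "card (bicentralizer v) = 4"
        "\<And>y. y \<in> carrier G - bicentralizer v \<Longrightarrow> y [^] (3::nat) = \<one>"
        using order_4_bicentralizer_if_many_centralizers[OF nonab many] by blast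
      then have "\<exists>w. A4_coordinates G w"
        by (rule A4_coordinates_if_order_4_bicentralizer[OF nonab])
      then show ?thesis using is_iso_if_A4_coordinates A4_coordinates_alt_group by blast
    qed
  qed
qed

end

theorem theorem2p22:
  fixes G :: "('a, 'b) monoid_scheme"
  assumes "group G" and "finite (carrier G)" and "\<not> comm_group G"
  shows "(F_group G \<and> real (card (Cent G)) \<ge> real (order G) / 2) \<longleftrightarrow>
     (G \<cong> alt_group 4 \<or>
      extraspecial 2 G \<or>
      (\<exists>H. frobenius_complement G H \<and> card H = 2 \<and>
           comm_group (G\<lparr>carrier := frobenius_kernel G H\<rparr>)))"
    (is "?L \<longleftrightarrow> ?R")
proof -
  interpret group G by fact
  have bound: "real (card (Cent G)) \<ge> real (order G) / 2 \<longleftrightarrow> order G \<le> 2 * card (Cent G)"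
    by linarith
  show ?thesis
  proof
    assume ?L
    then show ?R
      using bound by (intro cases_if_F_group_many_centralizers[OF assms(2,3)]) simp_all
  next
    assume ?R
    then consider (alt) "G \<cong> alt_group 4" | (es) "extraspecial 2 G"
      | (frob) H where "frobenius_complement G H" "card H = 2"
          "comm_group (G\<lparr>carrier := frobenius_kernel G H\<rparr>)"
      by blast
    then have "F_group G \<and> order G \<le> 2 * card (Cent G)"
    proof cases
      case alt
      then obtain w where "A4_coordinates G w"
        using A4_coordinates_transfer[OF assms(1)] A4_coordinates_alt_group by blast
      from F_group_if_A4_coordinates[OF assms(1) this] show ?thesis by simp
    next
      case es
      from F_group_many_centralizers_if_extraspecial[OF this] show ?thesis by blast
    next
      case frob
      from F_group_many_centralizers_if_frobenius[OF this] show ?thesis by blast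
    qed
    then show ?L using bound by blast
  qed
qed

end
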